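(* Let $n\ge 2$ and let $\zeta_1,\dots,\zeta_{n-1}$ be arbitrary (not necessarily distinct) points of the open upper half-plane $\mathbb H$. Consider the system $$(\mathrm{E}_{n-1})\qquad \sum_{\substack{j=1\\ j\neq k}}^{n-1}\frac{2}{t_k-t_j}-\sum_{j=1}^{n-1}\left(\frac{1}{t_k-\zeta_j}+\frac{1}{t_k-\overline{\zeta}_j}\right)=0,\qquad k=1,\dots,n-1,$$ for pairwise distinct real unknowns $t_1,\dots,t_{n-1}$, and the system $$(\mathrm{E}_{n})\qquad \sum_{\substack{j=1\\ j\neq k}}^{n}\frac{2}{x_k-x_j}-\sum_{j=1}^{n-1}\left(\frac{1}{x_k-\zeta_j}+\frac{1}{x_k-\overline{\zeta}_j}\right)=0,\qquad k=1,\dots,n,$$ for pairwise distinct real unknowns $x_1,\dots,x_n$. Then: (i) The system $(\mathrm{E}_{n-1})$ has a unique solution with $t_1<t_2<\dots<t_{n-1}$. It realizes the global minimum of the potential energy $$W(t_1,\dots,t_{n-1})=\sum_{1\le k,j\le n-1}\log\big|(t_k-\zeta_j)(t_k-\overline{\zeta}_j)\big|-2\sum_{1\le k<j\le n-1}\log|t_j-t_k|$$ (defined for pairwise distinct real $t_1,\dots,t_{n-1}$), and it is, up to a rearrangement of the $t_k$, the only critical point of $W$. (ii) Let $t_1<\dots<t_{n-1}$ be the solution from (i), put additionally $t_0:=-\infty$, $t_n:=+\infty$, and fix $k_0\in\{1,2,\dots,n\}$. For every $x_{k_0}\in(t_{k_0-1},t_{k_0})$ there are unique points $x_k\in(t_{k-1},t_k)$,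 for $k=1,\dots,k_0-1,k_0+1,\dots,n$, such that $(\mathrm{E}_n)$ is satisfied. All $x_k$ depend continuously and monotonically on $x_{k_0}$, and $x_k\to t_{k-1}$ for every $k$ if $x_{k_0}\to t_{k_0-1}$, and $x_k\to t_k$ for every $k$ if $x_{k_0}\to t_{k_0}$.
   Context: $\mathbb H=\{x+\mathrm i y: x\in\mathbb R,\ y>0\}$. Empty sums are $0$. In (ii) the points $x_k$ ($k\ne k_0$) are regarded as functions of $x_{k_0}$ on the interval $(t_{k_0-1},t_{k_0})$. A critical point of $W$ is a point at which all partial derivatives $\partial W/\partial t_k$ vanish. *)

theory Defs
  imports "HOL-Analysis.Interval_Integral" "HOL-Combinatorics.Permutations"
begin

text \<open>
  The system with \<open>m\<close> pairwise distinct real unknowns \<open>x 1, \<dots>, x m\<close>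
  and \<open>r\<close> given points \<open>\<zeta> 1, \<dots>, \<zeta> r\<close>.  The equations are read in the
  complex numbers; both \<open>(E\<^sub>n\<^sub>-\<^sub>1)\<close> (\<open>m = n - 1\<close>) and \<open>(E\<^sub>n)\<close> (\<open>m = n\<close>) have \<open>r = n - 1\<close>.
\<close>

definition stieltjes_system :: "nat \<Rightarrow> nat \<Rightarrow> (nat \<Rightarrow> complex) \<Rightarrow> (nat \<Rightarrow> real) \<Rightarrow> bool" where
  "stieltjes_system m r \<zeta> x \<longleftrightarrow>
     inj_on x {1..m} \<and>
     (\<forall>k\<in>{1..m}.
        (\<Sum>j\<in>{1..m} - {k}. 2 / (complex_of_real (x k) - complex_of_real (x j)))
        - (\<Sum>j=1..r. 1 / (complex_of_real (x k) - \<zeta> j)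
                     + 1 / (complex_of_real (x k) - cnj (\<zeta> j))) = 0)"

text \<open>
  The energy is meaningful only for pairwise distinct \<open>t 1, \<dots>, t m\<close>
  (recall \<open>ln 0 = 0\<close>); every use below is restricted to such points.
\<close>

definition energy :: "nat \<Rightarrow> (nat \<Rightarrow> complex) \<Rightarrow> (nat \<Rightarrow> real) \<Rightarrow> real" where
  "energy m \<zeta> t =
     (\<Sum>k=1..m. \<Sum>j=1..m.
        ln (cmod ((complex_of_real (t k) - \<zeta> j) * (complex_of_real (t k) - cnj (\<zeta> j)))))
     - 2 * (\<Sum>k=1..m. \<Sum>j\<in>{k<..m}. ln \<bar>t j - t k\<bar>)"

definition energy_critical_point :: "nat \<Rightarrow> (nat \<Rightarrow> complex) \<Rightarrow> (nat \<Rightarrow> real) \<Rightarrow> bool" where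
  "energy_critical_point m \<zeta> t \<longleftrightarrow>
     inj_on t {1..m} \<and>
     (\<forall>k\<in>{1..m}. ((\<lambda>u. energy m \<zeta> (t(k := u))) has_real_derivative 0) (at (t k)))"

text \<open>
  Points of \<open>\<real>\<^sup>m\<close> are functions on \<open>{1..m}\<close>, extended by \<open>undefined\<close> so that
  uniqueness is literal equality.
\<close>

definition ordered_solution :: "nat \<Rightarrow> (nat \<Rightarrow> complex) \<Rightarrow> (nat \<Rightarrow> real) \<Rightarrow> bool" where
  "ordered_solution n \<zeta> t \<longleftrightarrow>
     t \<in> {1..n-1} \<rightarrow>\<^sub>E UNIV \<and> strict_mono_on {1..n-1} t \<and> stieltjes_system (n - 1) (n - 1) \<zeta> t"

definition ext_node :: "nat \<Rightarrow> (nat \<Rightarrow> real) \<Rightarrow> nat \<Rightarrow> ereal" where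
  "ext_node n t k = (if k = 0 then -\<infinity> else if k = n then \<infinity> else ereal (t k))"

definition gap :: "nat \<Rightarrow> (nat \<Rightarrow> real) \<Rightarrow> nat \<Rightarrow> real set" where
  "gap n t k = einterval (ext_node n t (k - 1)) (ext_node n t k)"

definition interlacing_solution ::
  "nat \<Rightarrow> (nat \<Rightarrow> complex) \<Rightarrow> (nat \<Rightarrow> real) \<Rightarrow> nat \<Rightarrow> real \<Rightarrow> (nat \<Rightarrow> real) \<Rightarrow> bool" where
  "interlacing_solution n \<zeta> t k0 u x \<longleftrightarrow>
     x \<in> (\<Pi>\<^sub>E k\<in>{1..n}. gap n t k) \<and> x k0 = u \<and> stieltjes_system n (n - 1) \<zeta> x"

end

theory Submission
  imports Defs "HOL-Computational_Algebra.Polynomial" "HOL-Analysis.Complex_Analysis_Basics"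
begin

text \<open>
  Let \<open>R(z) = \<Prod> (z - \<zeta> j) (z - cnj (\<zeta> j))\<close> and \<open>T(z) = \<Prod> (z - t k)\<close>.  The Stieltjes equations for the
  \<open>t k\<close> say that \<open>R / T\<^sup>2\<close> has no residues, i.e. \<open>R / T\<^sup>2 = F'\<close> with \<open>F z = c z - \<Sum> a k / (z - t k)\<close>
  and \<open>a k > 0\<close>, where \<open>c = 1\<close> for \<open>n - 1\<close> nodes and \<open>c = 0\<close> for \<open>n\<close> nodes.  Such \<open>F\<close> maps the upper
  half-plane to itself, and its critical points there are the \<open>\<zeta> j\<close>.  For two such functions with the same
  \<open>R\<close>, the maximum principle applied to the logarithm of the quotient of the densities
  \<open>\<bar>F'\<bar> / Im F\<close> shows that these densities agree; after polarization the Bezoutians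
  \<open>T(x) T(y) (F x - F y) / (x - y)\<close> agree.  This gives uniqueness in (i), and it shows that the solutions
  in (ii) are exactly the level sets of the \<open>F\<close> belonging to the \<open>t k\<close>, which increases from
  \<open>-\<infinity>\<close> to \<open>\<infinity>\<close> on every gap.  Existence in (i) follows by maximizing \<open>exp (- W)\<close>, which is
  continuous and decays at infinity.
\<close>

section \<open>Residue-free representations\<close>

text \<open>The energy is not convex, because \<open>ln ((t - a)^2 + b^2)\<close> is not, so
  uniqueness of the critical point cannot come from convexity. The substitute is conformal. The
  density |F'| / Im F is the hyperbolic metric pulled back by F, and two such metrics with the same
  zeros are compared in the manner of the Ahlfors-Schwarz lemma. Since T^2 F' = R for both
  functions, comparing densities amounts to comparing the forms |T|^2 Im F / Im z. These are
  continuous up to the real axis, nodes included, and there both equal R. A real Moebius map of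
  determinant 1 applied to F leaves the density unchanged, so F itself cannot be recovered from it;
  the Bezoutian is a polynomial with the same invariance. This freedom is what produces the family
  in (ii): if F has c = 1, then 1 / (l - F) has the same R, has c = 0, and its poles are the level
  set F = l.\<close>

definition node_poly :: "'b set \<Rightarrow> ('b \<Rightarrow> 'a::idom) \<Rightarrow> 'a poly" where
  "node_poly I x = (\<Prod>i\<in>I. [:- x i, 1:])"

lemma poly_node_poly: "poly (node_poly I x) z = (\<Prod>i\<in>I. z - x i)"
  unfolding node_poly_def by (simp add: poly_prod)

lemma degree_node_poly: "degree (node_poly I x) = card I"
  unfolding node_poly_def by (subst degree_prod_eq_sum_degree) auto

lemma coeff_node_poly: "coeff (node_poly I x) (card I) = 1"
proof -
  have "lead_coeff (node_poly I x) = 1"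
    unfolding node_poly_def by (subst lead_coeff_prod) simp
  then show ?thesis by (simp add: degree_node_poly)
qed

lemma node_poly_nonzero: "node_poly I x \<noteq> 0"
  using coeff_node_poly[of I x] by (metis coeff_0 zero_neq_one)

lemma node_poly_dvd:
  fixes p :: "'a::field poly"
  assumes "finite I" "inj_on x I" "\<And>i. i \<in> I \<Longrightarrow> poly p (x i) = 0"
  shows "node_poly I x dvd p"
  using assms
proof (induction I arbitrary: p rule: finite_induct)
  case empty
  then show ?case by (simp add: node_poly_def)
next
  case (insert i I)
  from insert.prems have "poly p (x i) = 0" by simp
  then obtain q where q: "p = [:- x i, 1:] * q"
    by (auto simp: poly_eq_0_iff_dvd elim: dvdE)
  have "node_poly I x dvd q"
  proof (rule insert.IH)
    show "inj_on x I" using insert.prems by simp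
    fix j assume "j \<in> I"
    then have "x j \<noteq> x i" "poly p (x j) = 0" using insert.hyps insert.prems by (auto simp: inj_on_def)
    then show "poly q (x j) = 0" by (simp add: q)
  qed
  then show ?case
    using insert.hyps by (simp add: node_poly_def q mult_dvd_mono del: mult_pCons_left)
qed

lemma pderiv_sum: "pderiv (\<Sum>i\<in>I. p i) = (\<Sum>i\<in>I. pderiv (p i))"
  by (induction I rule: infinite_finite_induct) (auto simp: pderiv_add)

lemma poly_pderiv_prod:
  fixes p :: "'b \<Rightarrow> 'a::field poly"
  assumes "finite I" "\<And>i. i \<in> I \<Longrightarrow> poly (p i) z \<noteq> 0"
  shows "poly (pderiv (\<Prod>i\<in>I. p i)) z =
    poly (\<Prod>i\<in>I. p i) z * (\<Sum>i\<in>I. poly (pderiv (p i)) z / poly (p i) z)"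
  using assms
proof (induction I rule: finite_induct)
  case empty
  then show ?case by simp
next
  case (insert i I)
  then show ?case by (simp add: pderiv_mult field_simps)
qed

lemma poly_pderiv_node_poly:
  fixes x :: "'b \<Rightarrow> 'a::field"
  assumes "finite I" "\<And>i. i \<in> I \<Longrightarrow> x i \<noteq> z"
  shows "poly (pderiv (node_poly I x)) z = poly (node_poly I x) z * (\<Sum>i\<in>I. 1 / (z - x i))"
  unfolding node_poly_def
  by (subst poly_pderiv_prod) (use assms in \<open>auto simp: pderiv_pCons\<close>)

text \<open>Uniqueness in Hermite interpolation with double nodes. Once the node polynomial is
  divided out, the derivative of \<open>p\<close> at a node is the quotient's value there times a
  nonzero cofactor. So the quotient vanishes at all nodes as well, and a nonzero \<open>p\<close>
  would have degree at least \<open>2 * card I\<close>.\<close>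

lemma double_nodes_zero:
  fixes p :: "'a::field poly"
  assumes "finite I" "inj_on x I" "\<And>i. i \<in> I \<Longrightarrow> poly p (x i) = 0"
    and "\<And>i. i \<in> I \<Longrightarrow> poly (pderiv p) (x i) = 0" and "degree p < 2 * card I"
  shows "p = 0"
proof (rule ccontr)
  assume "p \<noteq> 0"
  obtain q where q: "p = node_poly I x * q"
    using node_poly_dvd[OF assms(1-3)] by (auto elim: dvdE)
  have "poly q (x i) = 0" if "i \<in> I" for i
  proof -
    have split: "node_poly I x = [:- x i, 1:] * node_poly (I - {i}) x"
      unfolding node_poly_def using that assms(1) by (simp add: prod.remove)
    have "poly (node_poly (I - {i}) x) (x i) \<noteq> 0"
      using that assms(1,2) by (auto simp: poly_node_poly inj_on_def)
    moreover have "poly (pderiv p) (x i) = poly (node_poly (I - {i}) x) (x i) * poly q (x i)"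
      unfolding q split by (simp add: pderiv_mult pderiv_pCons del: mult_pCons_left)
    ultimately show ?thesis using assms(4)[OF that] by simp
  qed
  then obtain r where r: "q = node_poly I x * r"
    using node_poly_dvd[OF assms(1,2)] by (metis dvdE)
  have "r \<noteq> 0" using \<open>p \<noteq> 0\<close> q r by auto
  then have "degree p = card I + (card I + degree r)"
    unfolding q r by (simp add: degree_mult_eq node_poly_nonzero degree_node_poly)
  then show False using assms(5) by simp
qed

text \<open>
  With \<open>w i = (z - t i)\<^sup>2\<close> this is \<open>T\<^sup>2 F'\<close> for \<open>T = \<Prod>(z - t i)\<close> and
  \<open>F z = c z - \<Sum> a k / (z - t k)\<close>; with \<open>w i = \<bar>z - t i\<bar>\<^sup>2\<close> it is \<open>\<bar>T\<bar>\<^sup>2 Im F / Im z\<close>; and with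
  \<open>w i = (\<alpha> - t i) (\<beta> - t i)\<close> it is the Bezoutian \<open>T(\<alpha>) T(\<beta>) (F \<alpha> - F \<beta>) / (\<alpha> - \<beta>)\<close>.
\<close>

definition pform :: "'b set \<Rightarrow> 'a \<Rightarrow> ('b \<Rightarrow> 'a) \<Rightarrow> ('b \<Rightarrow> 'a) \<Rightarrow> 'a::comm_ring_1" where
  "pform I c a w = c * prod w I + (\<Sum>k\<in>I. a k * prod w (I - {k}))"

text \<open>A form with polynomial entries evaluates pointwise, so degree and root-counting
  arguments can be run on \<open>pform\<close> itself.\<close>

lemma poly_pform: "poly (pform I c a w) z = pform I (poly c z) (\<lambda>k. poly (a k) z) (\<lambda>i. poly (w i) z)"
  by (simp add: pform_def poly_prod poly_sum)

lemma pform_of_real: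
  "pform I (of_real c) (\<lambda>k. of_real (a k)) (\<lambda>i. of_real (w i)) =
   (of_real (pform I c a w) :: 'a::{comm_ring_1, real_algebra_1})"
  by (simp add: pform_def of_real_prod of_real_sum)

text \<open>The form is a partial fraction sum with its denominators cleared. Unlike the fraction it
  still makes sense at a node, where \<open>pform_at_zero\<close> evaluates it.\<close>

lemma pform_nonzero:
  fixes w :: "'b \<Rightarrow> 'a::field"
  assumes "finite I" "\<And>i. i \<in> I \<Longrightarrow> w i \<noteq> 0"
  shows "pform I c a w = prod w I * (c + (\<Sum>k\<in>I. a k / w k))"
proof -
  have "a k * prod w (I - {k}) = prod w I * (a k / w k)" if "k \<in> I" for k
    using that assms by (simp add: prod.remove)
  then show ?thesis by (simp add: pform_def algebra_simps sum_distrib_left)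
qed

lemma pform_at_zero:
  fixes w :: "'b \<Rightarrow> 'a::comm_ring_1"
  assumes "finite I" "k \<in> I" "w k = 0"
  shows "pform I c a w = a k * prod w (I - {k})"
proof -
  have "prod w I = 0" using assms by (metis prod_zero)
  moreover have "a j * prod w (I - {j}) = 0" if "j \<in> I - {k}" for j
    using prod_zero[of "I - {j}" w] assms that
    by (metis DiffD1 DiffI DiffD2 finite_Diff mult_zero_right singletonD singletonI)
  ultimately show ?thesis
    unfolding pform_def using assms by (simp add: sum.remove sum.neutral)
qed

lemma prod_square_node_poly: "(\<Prod>i\<in>I. [:- x i, 1:]\<^sup>2) = (node_poly I x)\<^sup>2"
  by (simp add: node_poly_def prod_power_distrib)

lemma pform_square_poly:
  "pform I [:c:] (\<lambda>k. [:a k:]) (\<lambda>i. [:- x i, 1:]\<^sup>2) =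
   smult c ((node_poly I x)\<^sup>2) + (\<Sum>k\<in>I. smult (a k) ((node_poly (I - {k}) x)\<^sup>2))"
  unfolding pform_def prod_square_node_poly by simp

lemma prod_smult: "(\<Prod>i\<in>I. smult (c i) (p i)) = smult (prod c I) (prod p I)"
  for c :: "'b \<Rightarrow> 'a::comm_ring_1"
  by (induction I rule: infinite_finite_induct) (auto simp: mult_ac)

lemma pform_bezout_poly:
  "pform I [:c:] (\<lambda>k. [:a k:]) (\<lambda>i. smult (b - x i) [:- x i, 1:]) =
   smult (c * poly (node_poly I x) b) (node_poly I x) +
   (\<Sum>k\<in>I. smult (a k * poly (node_poly (I - {k}) x) b) (node_poly (I - {k}) x))"
  unfolding pform_def prod_smult by (simp add: node_poly_def poly_prod mult.commute)

lemma degree_pform_bezout: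
  fixes x :: "'b \<Rightarrow> 'a::idom"
  assumes "finite I"
  shows "degree (pform I [:c:] (\<lambda>k. [:a k:]) (\<lambda>i. smult (b - x i) [:- x i, 1:])) \<le> card I"
  unfolding pform_bezout_poly
  by (intro degree_add_le degree_sum_le order_trans[OF degree_smult_le] assms)
     (auto simp: degree_node_poly card_Diff_singleton)

text \<open>For \<open>c = 1\<close> the top coefficient of the Bezoutian in one variable is the
  node polynomial in the other, so the Bezoutian determines the nodes.\<close>

lemma coeff_pform_bezout:
  fixes x :: "'b \<Rightarrow> 'a::idom"
  assumes "finite I"
  shows "coeff (pform I [:c:] (\<lambda>k. [:a k:]) (\<lambda>i. smult (b - x i) [:- x i, 1:])) (card I) =
    c * poly (node_poly I x) b"
proof -
  have "coeff (node_poly (I - {k}) x) (card I) = 0" if "k \<in> I" for k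
    using that assms card_Diff1_less[of I k] by (intro coeff_eq_0) (simp add: degree_node_poly)
  then show ?thesis
    unfolding pform_bezout_poly by (simp add: coeff_node_poly coeff_sum)
qed

text \<open>
  Vanishing of the residue of \<open>R / T\<^sup>2\<close> at each node is exactly the Stieltjes equation there, so
  \<open>R - c T\<^sup>2 - \<Sum> a k (T / (z - x k))\<^sup>2\<close> has a double zero at each node.
\<close>

lemma pform_representation:
  fixes R :: "'a::field poly"
  assumes fin: "finite I" and inj: "inj_on x I"
    and deg: "degree (R - smult c ((node_poly I x)\<^sup>2)) < 2 * card I"
    and eq: "\<And>k. k \<in> I \<Longrightarrow> poly (pderiv R) (x k) =
      poly R (x k) * (\<Sum>j\<in>I - {k}. 2 / (x k - x j))"
    and a: "\<And>k. k \<in> I \<Longrightarrow> a k = poly R (x k) / (\<Prod>j\<in>I - {k}. x k - x j)\<^sup>2"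
  shows "poly R z = pform I c a (\<lambda>i. (z - x i)\<^sup>2)"
proof -
  define N where "N k = node_poly (I - {k}) x" for k
  define S where "S = (\<Sum>k\<in>I. smult (a k) ((N k)\<^sup>2))"
  define D where "D = R - smult c ((node_poly I x)\<^sup>2) - S"
  have node0: "poly (node_poly I x) (x i) = 0" if "i \<in> I" for i
    using that fin by (auto simp: poly_node_poly)
  have N0: "poly (N k) (x i) = 0" if "i \<in> I" "k \<noteq> i" for i k
    using that fin by (auto simp: poly_node_poly N_def)
  have N1: "poly (N k) (x k) \<noteq> 0" if "k \<in> I" for k
    using that fin inj by (auto simp: poly_node_poly N_def inj_on_def)
  have "D = 0"
  proof (rule double_nodes_zero[OF fin inj])
    have "degree S \<le> 2 * (card I - 1)"
      unfolding S_def
    proof (intro degree_sum_le fin order_trans[OF degree_smult_le])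
      fix k assume "k \<in> I"
      then show "degree ((N k)\<^sup>2) \<le> 2 * (card I - 1)"
        using fin by (simp add: N_def degree_power_eq node_poly_nonzero degree_node_poly)
    qed
    moreover have "card I > 0" using deg by simp
    ultimately have "degree S < 2 * card I" by linarith
    then show "degree D < 2 * card I" unfolding D_def using degree_diff_less[OF deg] by simp
  next
    fix i assume i: "i \<in> I"
    \<comment> \<open>The squares \<open>(N k)^2\<close> with k different from i have a double zero
      at \<open>x i\<close>, so only the summand of i contributes to the value and to the derivative
      there.\<close>
    have S: "poly S (x i) = a i * (poly (N i) (x i))\<^sup>2"
      unfolding S_def poly_sum using i fin
      by (subst sum.remove[of _ i]) (auto simp: N0 intro!: sum.neutral)
    have ai: "a i * (poly (N i) (x i))\<^sup>2 = poly R (x i)"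
      using a[OF i] N1[OF i] by (simp add: N_def poly_node_poly)
    show "poly D (x i) = 0" using S ai node0[OF i] by (simp add: D_def)
    have "poly (pderiv S) (x i) = a i * (2 * poly (N i) (x i) * poly (pderiv (N i)) (x i))"
    proof -
      have "poly (pderiv S) (x i) =
          (\<Sum>k\<in>I. a k * (2 * poly (N k) (x i) * poly (pderiv (N k)) (x i)))"
        unfolding S_def
        by (simp add: pderiv_sum poly_sum pderiv_smult power2_eq_square pderiv_mult algebra_simps)
      also have "\<dots> = a i * (2 * poly (N i) (x i) * poly (pderiv (N i)) (x i))"
        using i fin by (subst sum.remove[of _ i]) (auto simp: N0 intro!: sum.neutral)
      finally show ?thesis .
    qed
    also have "poly (pderiv (N i)) (x i) = poly (N i) (x i) * (\<Sum>j\<in>I - {i}. 1 / (x i - x j))"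
      unfolding N_def using fin inj i by (intro poly_pderiv_node_poly) (auto simp: inj_on_def)
    finally have "poly (pderiv S) (x i) =
        (a i * (poly (N i) (x i))\<^sup>2) * (2 * (\<Sum>j\<in>I - {i}. 1 / (x i - x j)))"
      by (simp add: power2_eq_square algebra_simps)
    also have "\<dots> = poly (pderiv R) (x i)"
      unfolding ai eq[OF i] by (simp add: sum_distrib_left)
    finally show "poly (pderiv D) (x i) = 0"
      using node0[OF i] by (simp add: D_def pderiv_diff pderiv_smult power2_eq_square pderiv_mult)
  qed
  then have "R = pform I [:c:] (\<lambda>k. [:a k:]) (\<lambda>i. [:- x i, 1:]\<^sup>2)"
    unfolding pform_square_poly by (simp add: D_def S_def N_def algebra_simps)
  then show ?thesis by (simp add: poly_pform)
qed

text \<open>Freeze one argument of the Bezoutian at \<open>b\<close>. The resulting polynomial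
  \<open>K\<close> has degree at most \<open>card I\<close> and already \<open>card J\<close> known
  roots, so it is a constant times the product of the \<open>z - y j\<close>. Its logarithmic
  derivative at \<open>b\<close> is therefore the sum of the \<open>1 / (b - y j)\<close>. On the
  diagonal the Bezoutian is \<open>R\<close>, which turns this into a statement about
  \<open>R\<close>.\<close>

lemma bezout_nodes_log_derivative:
  fixes R :: "'a::field_char_0 poly"
  assumes fin: "finite I" "finite J" and card: "card I \<le> card J" and inj: "inj_on y J"
    and R: "\<And>z. poly R z = pform I c a (\<lambda>i. (z - x i)\<^sup>2)"
    and zero: "\<And>j. j \<in> J \<Longrightarrow> pform I c a (\<lambda>i. (y j - x i) * (b - x i)) = 0"
    and nz: "poly R b \<noteq> 0"
  shows "poly (pderiv R) b = poly R b * (\<Sum>j\<in>J. 2 / (b - y j))"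
proof -
  define K where "K = pform I [:c:] (\<lambda>k. [:a k:]) (\<lambda>i. smult (b - x i) [:- x i, 1:])"
  have polyK: "poly K z = pform I c a (\<lambda>i. (z - x i) * (b - x i))" for z
    unfolding K_def poly_pform by (simp add: algebra_simps)
  have Kb: "poly K b = poly R b" by (simp add: polyK R power2_eq_square)
  have "K \<noteq> 0" using nz Kb by auto
  have "node_poly J y dvd K" using zero by (intro node_poly_dvd fin inj) (simp add: polyK)
  then obtain q where q: "K = node_poly J y * q" by (auto elim: dvdE)
  have "q \<noteq> 0" using \<open>K \<noteq> 0\<close> q by auto
  then have "degree K = card J + degree q"
    unfolding q by (simp add: degree_mult_eq node_poly_nonzero degree_node_poly)
  moreover have "degree K \<le> card I" unfolding K_def by (rule degree_pform_bezout[OF fin(1)])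
  ultimately have "degree q = 0" using card by simp
  then obtain d where d: "q = [:d:]" by (auto elim: degree_eq_zeroE)
  have yb: "y j \<noteq> b" if "j \<in> J" for j
  proof
    assume "y j = b"
    then have "poly K b = 0" using that fin by (auto simp: q poly_node_poly)
    then show False using nz Kb by simp
  qed
  have Rp: "R = smult c ((node_poly I x)\<^sup>2) + (\<Sum>k\<in>I. smult (a k) ((node_poly (I - {k}) x)\<^sup>2))"
    unfolding pform_square_poly[symmetric]
    by (subst poly_eq_poly_eq_iff[symmetric]) (rule ext, simp add: R poly_pform)
  \<comment> \<open>The Bezoutian is symmetric, so its derivative along the diagonal is twice the
    partial derivative in one argument. This is the 2 in the Stieltjes equations.\<close>
  have "poly (pderiv R) b = 2 * poly (pderiv K) b"
    unfolding Rp K_def pform_bezout_poly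
    by (simp add: pderiv_add pderiv_sum poly_sum pderiv_smult power2_eq_square pderiv_mult
        algebra_simps sum_distrib_left)
  also have "poly (pderiv K) b = d * poly (pderiv (node_poly J y)) b"
    unfolding q d by (simp add: pderiv_mult pderiv_smult)
  also have "\<dots> = d * poly (node_poly J y) b * (\<Sum>j\<in>J. 1 / (b - y j))"
    using poly_pderiv_node_poly[OF fin(2), of y b] yb by simp
  also have "d * poly (node_poly J y) b = poly R b"
    unfolding Kb[symmetric] q d by simp
  finally show ?thesis by (simp add: sum_distrib_left mult_ac)
qed

section \<open>Laplacians of functions on the half-plane\<close>

lemma local_max_second_derivative_nonpos:
  fixes g g' :: "real \<Rightarrow> real"
  assumes d1: "\<forall>\<^sub>F s in nhds 0. (g has_real_derivative g' s) (at s)"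
    and d2: "(g' has_real_derivative D) (at 0)"
    and mx: "\<forall>\<^sub>F s in nhds 0. g s \<le> g 0"
  shows "D \<le> 0"
proof (rule ccontr)
  assume "\<not> D \<le> 0"
  then have "D > 0" by simp
  obtain e where e: "e > 0"
    "\<And>s. \<bar>s\<bar> < e \<Longrightarrow> (g has_real_derivative g' s) (at s) \<and> g s \<le> g 0"
    using eventually_conj[OF d1 mx] by (auto simp: eventually_nhds_metric dist_real_def)
  have "g' 0 = 0"
    by (rule DERIV_local_max[of g "g' 0" 0 e]) (use e in auto)
  obtain d where d: "d > 0" "\<And>h. 0 < h \<Longrightarrow> h < d \<Longrightarrow> g' 0 < g' (0 + h)"
    using DERIV_pos_inc_right[OF d2 \<open>D > 0\<close>] by auto
  define h where "h = min d e / 2"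
  have h: "0 < h" "h < d" "h < e" using d(1) e(1) by (auto simp: h_def)
  obtain s where s: "0 < s" "s < h" "g h - g 0 = (h - 0) * g' s"
    using MVT2[of 0 h g g'] h e(2) by force
  have "g' s > 0" using d(2)[of s] s h \<open>g' 0 = 0\<close> by simp
  then have "g h > g 0" using s(3) h by (simp add: algebra_simps zero_less_mult_iff)
  then show False using e(2)[of h] h by simp
qed

lemma tendsto_line: "((\<lambda>s. z + of_real s * d) \<longlongrightarrow> z) (nhds (0::real))" for z d :: complex
proof -
  have "isCont (\<lambda>s. z + of_real s * d) (0::real)" by (intro continuous_intros)
  then have "((\<lambda>s. z + of_real s * d) \<longlongrightarrow> z + of_real 0 * d) (nhds (0::real))"
    unfolding isCont_def
    by (rule iffD1[OF tendsto_at_iff_tendsto_nhds[of "\<lambda>s. z + of_real s * d"]])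
  then show ?thesis by simp
qed

text \<open>First and second derivative along a real line through \<open>z\<close>. The first
  derivative is carried along because the rule for \<open>ln\<close> needs it. Two directions give
  the Laplacian, so no differentiability in two variables has to be developed.\<close>

definition has_dir2 :: "(complex \<Rightarrow> real) \<Rightarrow> complex \<Rightarrow> complex \<Rightarrow> real \<Rightarrow> real \<Rightarrow> bool" where
  "has_dir2 v z d p q \<longleftrightarrow> (\<exists>g'.
     (\<forall>\<^sub>F s in nhds 0. ((\<lambda>s. v (z + of_real s * d)) has_real_derivative g' s) (at s)) \<and>
     g' 0 = p \<and> (g' has_real_derivative q) (at 0))"

lemma has_dir2_add:
  assumes "has_dir2 u z d p q" "has_dir2 v z d p' q'"
  shows "has_dir2 (\<lambda>w. u w + v w) z d (p + p') (q + q')"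
proof -
  obtain f g where fg:
    "\<forall>\<^sub>F s in nhds 0. ((\<lambda>s. u (z + of_real s * d)) has_real_derivative f s) (at s)"
    "f 0 = p" "(f has_real_derivative q) (at 0)"
    "\<forall>\<^sub>F s in nhds 0. ((\<lambda>s. v (z + of_real s * d)) has_real_derivative g s) (at s)"
    "g 0 = p'" "(g has_real_derivative q') (at 0)"
    using assms by (auto simp: has_dir2_def)
  show ?thesis
    unfolding has_dir2_def
  proof (intro exI[of _ "\<lambda>s. f s + g s"] conjI)
    show "\<forall>\<^sub>F s in nhds 0. ((\<lambda>s. u (z + of_real s * d) + v (z + of_real s * d))
        has_real_derivative f s + g s) (at s)"
      using fg(1,4) by eventually_elim (rule DERIV_add)
    show "((\<lambda>s. f s + g s) has_real_derivative q + q') (at 0)" by (intro DERIV_add fg)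
  qed (simp add: fg)
qed

lemma has_dir2_cmult:
  assumes "has_dir2 u z d p q"
  shows "has_dir2 (\<lambda>w. r * u w) z d (r * p) (r * q)"
proof -
  obtain f where f:
    "\<forall>\<^sub>F s in nhds 0. ((\<lambda>s. u (z + of_real s * d)) has_real_derivative f s) (at s)"
    "f 0 = p" "(f has_real_derivative q) (at 0)"
    using assms by (auto simp: has_dir2_def)
  show ?thesis
    unfolding has_dir2_def
  proof (intro exI[of _ "\<lambda>s. r * f s"] conjI)
    show "\<forall>\<^sub>F s in nhds 0. ((\<lambda>s. r * u (z + of_real s * d)) has_real_derivative r * f s) (at s)"
      using f(1) by eventually_elim (rule DERIV_cmult)
    show "((\<lambda>s. r * f s) has_real_derivative r * q) (at 0)" by (intro DERIV_cmult f)
  qed (simp add: f)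
qed

lemma has_dir2_const: "has_dir2 (\<lambda>_. r) z d 0 0"
  unfolding has_dir2_def by (intro exI[of _ "\<lambda>_. 0"]) auto

lemma has_dir2_diff:
  assumes "has_dir2 u z d p q" "has_dir2 v z d p' q'"
  shows "has_dir2 (\<lambda>w. u w - v w) z d (p - p') (q - q')"
  using has_dir2_add[OF assms(1) has_dir2_cmult[OF assms(2), of "-1"]] by simp

lemma has_dir2_ln:
  assumes "has_dir2 u z d p q" "u z > 0"
  shows "has_dir2 (\<lambda>w. ln (u w)) z d (p / u z) (q / u z - (p / u z)\<^sup>2)"
proof -
  define g where "g s = u (z + of_real s * d)" for s
  obtain f where f:
    "\<forall>\<^sub>F s in nhds 0. (g has_real_derivative f s) (at s)"
    "f 0 = p" "(f has_real_derivative q) (at 0)"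
    using assms(1) unfolding has_dir2_def g_def by blast
  have g0: "g 0 > 0" "g 0 = u z" using assms(2) by (simp_all add: g_def)
  have dg0: "(g has_real_derivative p) (at 0)" using eventually_nhds_x_imp_x[OF f(1)] f(2) by simp
  then have "isCont g 0" by (rule DERIV_isCont)
  then have "(g \<longlongrightarrow> g 0) (nhds 0)"
    by (simp add: isCont_def tendsto_at_iff_tendsto_nhds)
  then have pos: "\<forall>\<^sub>F s in nhds 0. g s > 0" using g0(1) by (rule order_tendstoD)
  show ?thesis
    unfolding has_dir2_def g_def[symmetric]
  proof (intro exI[of _ "\<lambda>s. f s / g s"] conjI)
    show "\<forall>\<^sub>F s in nhds 0. ((\<lambda>s. ln (g s)) has_real_derivative f s / g s) (at s)"
      using f(1) pos
      by eventually_elim (auto intro!: derivative_eq_intros simp: field_simps)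
    show "f 0 / g 0 = p / u z" by (simp add: f g0)
    show "((\<lambda>s. f s / g s) has_real_derivative q / u z - (p / u z)\<^sup>2) (at 0)"
      by (rule DERIV_cong[OF DERIV_divide[OF f(3) dg0]])
         (use g0 in \<open>auto simp: f(2) field_simps power2_eq_square\<close>)
  qed
qed

text \<open>The factor \<open>d^2\<close> is 1 in the real and -1 in the imaginary direction. That
  cancellation is the harmonicity of Im G and removes G'' from
  \<open>has_laplacian_ln_Im\<close>.\<close>

lemma has_dir2_Im:
  assumes "open S" "z \<in> S" "\<And>w. w \<in> S \<Longrightarrow> (G has_field_derivative G' w) (at w)"
    and "(G' has_field_derivative G'') (at z)"
  shows "has_dir2 (\<lambda>w. Im (G w)) z d (Im (d * G' z)) (Im (d\<^sup>2 * G''))"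
proof -
  have line: "((\<lambda>s. z + of_real s * d) has_vector_derivative d) (at s)" for s :: real
    by (auto intro!: derivative_eq_intros simp: has_vector_derivative_def scaleR_conv_of_real)
  from tendsto_line have inS: "\<forall>\<^sub>F s in nhds (0::real). z + of_real s * d \<in> S"
    using assms(1,2) by (rule topological_tendstoD)
  have chain: "((\<lambda>s. Im (H (z + of_real s * d))) has_real_derivative Im (d * h)) (at s)"
    if "(H has_field_derivative h) (at (z + of_real s * d))" for H h and s :: real
  proof -
    have "((H \<circ> (\<lambda>s. z + of_real s * d)) has_vector_derivative d * h) (at s)"
      by (rule field_vector_diff_chain_at[OF line that])
    from bounded_linear.has_vector_derivative[OF bounded_linear_Im this]
    have "((\<lambda>s. Im (H (z + of_real s * d))) has_vector_derivative Im (d * h)) (at s)"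
      by (simp add: o_def)
    then show ?thesis by (simp add: has_real_derivative_iff_has_vector_derivative)
  qed
  show ?thesis
    unfolding has_dir2_def
  proof (intro exI[of _ "\<lambda>s. Im (d * G' (z + of_real s * d))"] conjI)
    show "\<forall>\<^sub>F s in nhds 0. ((\<lambda>s. Im (G (z + of_real s * d))) has_real_derivative
        Im (d * G' (z + of_real s * d))) (at s)"
      using inS by eventually_elim (rule chain, rule assms(3))
    have "((\<lambda>w. d * G' w) has_field_derivative d * G'') (at (z + of_real 0 * d))"
      using DERIV_cmult[OF assms(4), of d] by simp
    from chain[OF this]
    show "((\<lambda>s. Im (d * G' (z + of_real s * d))) has_real_derivative Im (d\<^sup>2 * G'')) (at 0)"
      by (simp add: power2_eq_square mult.assoc)
  qed simp
qed

lemma has_dir2_local_max: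
  assumes "has_dir2 v z d p q" "\<forall>\<^sub>F w in nhds z. v w \<le> v z"
  shows "q \<le> 0"
proof -
  from tendsto_line have "\<forall>\<^sub>F s in nhds (0::real). v (z + of_real s * d) \<le> v z"
    using assms(2) by (auto simp: filterlim_iff)
  with assms(1) show ?thesis
    unfolding has_dir2_def by (auto intro!: local_max_second_derivative_nonpos[of "\<lambda>s. v (z + of_real s * d)"])
qed

definition has_laplacian :: "(complex \<Rightarrow> real) \<Rightarrow> complex \<Rightarrow> real \<Rightarrow> bool" where
  "has_laplacian v z L \<longleftrightarrow> (\<exists>p q p' q'. has_dir2 v z 1 p q \<and> has_dir2 v z \<i> p' q' \<and> L = q + q')"

lemma has_laplacianI:
  assumes "has_dir2 v z 1 p q" "has_dir2 v z \<i> p' q'" "L = q + q'"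
  shows "has_laplacian v z L"
  using assms unfolding has_laplacian_def by blast

lemma has_laplacian_add:
  assumes "has_laplacian u z L" "has_laplacian v z M"
  shows "has_laplacian (\<lambda>w. u w + v w) z (L + M)"
  using assms unfolding has_laplacian_def[of u] has_laplacian_def[of v]
  by (auto intro!: has_laplacianI intro: has_dir2_add)

lemma has_laplacian_diff:
  assumes "has_laplacian u z L" "has_laplacian v z M"
  shows "has_laplacian (\<lambda>w. u w - v w) z (L - M)"
  using assms unfolding has_laplacian_def[of u] has_laplacian_def[of v]
  by (auto intro!: has_laplacianI intro: has_dir2_diff)

lemma has_laplacian_cmult:
  assumes "has_laplacian u z L"
  shows "has_laplacian (\<lambda>w. r * u w) z (r * L)"
  using assms unfolding has_laplacian_def[of u]
  by (auto intro!: has_laplacianI intro: has_dir2_cmult simp: distrib_left)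

lemma has_laplacian_sum:
  assumes "\<And>i. i \<in> I \<Longrightarrow> has_laplacian (u i) z (L i)"
  shows "has_laplacian (\<lambda>w. \<Sum>i\<in>I. u i w) z (\<Sum>i\<in>I. L i)"
  using assms
  by (induction I rule: infinite_finite_induct)
     (auto intro: has_laplacian_add has_laplacianI[OF has_dir2_const has_dir2_const])

lemma has_laplacian_local_max:
  assumes "has_laplacian v z L" "\<forall>\<^sub>F w in nhds z. v w \<le> v z"
  shows "L \<le> 0"
proof -
  obtain p q p' q' where "has_dir2 v z 1 p q" "has_dir2 v z \<i> p' q'" "L = q + q'"
    using assms(1) unfolding has_laplacian_def by blast
  with has_dir2_local_max[OF _ assms(2)] show ?thesis by (metis add_nonpos_nonpos)
qed

text \<open>With r the squared distance to \<open>t\<close>, both second derivatives of r are 2 and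
  its squared gradient is 4 r, so the Laplacian is 4 / r - 4 r / r^2. Working with r directly avoids
  a branch of the complex logarithm.\<close>

lemma has_laplacian_ln_norm:
  assumes "z \<noteq> t"
  shows "has_laplacian (\<lambda>w. ln ((cmod (w - t))\<^sup>2)) z 0"
proof -
  define r where "r = (cmod (z - t))\<^sup>2"
  have r: "r > 0" "r = (Re (z - t))\<^sup>2 + (Im (z - t))\<^sup>2"
    using assms by (simp_all add: r_def cmod_power2[of "z - t", symmetric] del: minus_complex.simps)
  have dir1: "has_dir2 (\<lambda>w. (cmod (w - t))\<^sup>2) z 1 (2 * Re (z - t)) 2"
    unfolding has_dir2_def cmod_power2
    by (intro exI[of _ "\<lambda>s. 2 * (Re (z - t) + s)"])
       (auto intro!: derivative_eq_intros always_eventually simp: algebra_simps)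
  have diri: "has_dir2 (\<lambda>w. (cmod (w - t))\<^sup>2) z \<i> (2 * Im (z - t)) 2"
    unfolding has_dir2_def cmod_power2
    by (intro exI[of _ "\<lambda>s. 2 * (Im (z - t) + s)"])
       (auto intro!: derivative_eq_intros always_eventually simp: algebra_simps)
  show ?thesis
  proof (rule has_laplacianI[OF has_dir2_ln[OF dir1] has_dir2_ln[OF diri]])
    have "2 / r + 2 / r - ((2 * Re (z - t))\<^sup>2 + (2 * Im (z - t))\<^sup>2) / r\<^sup>2 = 0"
      using r(1) unfolding power_mult_distrib distrib_left[symmetric] r(2)[symmetric]
      by (simp add: power2_eq_square)
    then show "0 = 2 / (cmod (z - t))\<^sup>2 - (2 * Re (z - t) / (cmod (z - t))\<^sup>2)\<^sup>2 +
        (2 / (cmod (z - t))\<^sup>2 - (2 * Im (z - t) / (cmod (z - t))\<^sup>2)\<^sup>2)"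
      unfolding r_def[symmetric] by (simp add: power_divide add_divide_distrib)
  qed (use assms in auto)
qed

text \<open>As Im G is harmonic, only the gradient term of \<open>ln\<close> survives, and by the
  Cauchy-Riemann equations the gradient of Im G has length |G'|.\<close>

lemma has_laplacian_ln_Im:
  assumes "open S" "z \<in> S" "\<And>w. w \<in> S \<Longrightarrow> (G has_field_derivative G' w) (at w)"
    and "(G' has_field_derivative G'') (at z)" and "Im (G z) > 0"
  shows "has_laplacian (\<lambda>w. ln (Im (G w))) z (- (cmod (G' z) / Im (G z))\<^sup>2)"
proof (rule has_laplacianI[OF has_dir2_ln has_dir2_ln])
  show "has_dir2 (\<lambda>w. Im (G w)) z 1 (Im (1 * G' z)) (Im (1\<^sup>2 * G''))"
    by (rule has_dir2_Im[OF assms(1-4)])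
  show "has_dir2 (\<lambda>w. Im (G w)) z \<i> (Im (\<i> * G' z)) (Im (\<i>\<^sup>2 * G''))"
    by (rule has_dir2_Im[OF assms(1-4)])
  show "- (cmod (G' z) / Im (G z))\<^sup>2 =
      Im (1\<^sup>2 * G'') / Im (G z) - (Im (1 * G' z) / Im (G z))\<^sup>2 +
      (Im (\<i>\<^sup>2 * G'') / Im (G z) - (Im (\<i> * G' z) / Im (G z))\<^sup>2)"
    by (simp add: power_divide cmod_power2 add_divide_distrib)
qed (use assms in auto)

lemma has_laplacian_exp_Im: "has_laplacian (\<lambda>w. exp (- Im w)) z (exp (- Im z))"
proof (rule has_laplacianI)
  show "has_dir2 (\<lambda>w. exp (- Im w)) z 1 0 0"
    unfolding has_dir2_def by (intro exI[of _ "\<lambda>_. 0"]) auto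
  show "has_dir2 (\<lambda>w. exp (- Im w)) z \<i> (- exp (- Im z)) (exp (- Im z))"
    unfolding has_dir2_def
    by (intro exI[of _ "\<lambda>s. - exp (- (Im z + s))"])
       (auto intro!: derivative_eq_intros always_eventually)
qed simp

section \<open>Rational Nevanlinna functions and positivity of the forms\<close>

definition nevanlinna :: "'b set \<Rightarrow> real \<Rightarrow> ('b \<Rightarrow> real) \<Rightarrow> ('b \<Rightarrow> real) \<Rightarrow> complex \<Rightarrow> complex" where
  "nevanlinna I c a t z = of_real c * z - (\<Sum>k\<in>I. of_real (a k) / (z - of_real (t k)))"

lemma Im_nevanlinna:
  assumes "finite I" "Im z > 0"
  shows "(\<Prod>i\<in>I. (cmod (z - of_real (t i)))\<^sup>2) * Im (nevanlinna I c a t z) =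
    Im z * pform I c a (\<lambda>i. (cmod (z - of_real (t i)))\<^sup>2)"
proof -
  have nz: "z \<noteq> of_real (t i)" for i using assms(2) by auto
  have "Im (of_real (a k) / (z - of_real (t k))) = - (Im z * (a k / (cmod (z - of_real (t k)))\<^sup>2))" for k
    by (simp add: Im_divide cmod_power2)
  then have "Im (nevanlinna I c a t z) = Im z * (c + (\<Sum>k\<in>I. a k / (cmod (z - of_real (t k)))\<^sup>2))"
    by (simp add: nevanlinna_def sum_negf distrib_left sum_distrib_left)
  then show ?thesis
    using nz assms(1) by (subst pform_nonzero) auto
qed

lemma nevanlinna_derivative:
  assumes "finite I" "Im z > 0"
  shows "(nevanlinna I c a t has_field_derivative
    of_real c + (\<Sum>k\<in>I. of_real (a k) / (z - of_real (t k))\<^sup>2)) (at z)"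
proof -
  have nz: "z \<noteq> of_real (t i)" for i using assms(2) by auto
  have "((\<lambda>z. of_real c * z - (\<Sum>k\<in>I. of_real (a k) / (z - of_real (t k))))
      has_field_derivative of_real c * 1 - (\<Sum>k\<in>I. - of_real (a k) / (z - of_real (t k))\<^sup>2)) (at z)"
    using nz by (intro derivative_intros DERIV_sum)
      (auto intro!: derivative_eq_intros simp: power2_eq_square)
  then show ?thesis unfolding nevanlinna_def[abs_def] by (simp add: sum_negf)
qed

lemma nevanlinna_second_derivative:
  assumes "finite I" "Im z > 0"
  shows "\<exists>D. ((\<lambda>z. of_real c + (\<Sum>k\<in>I. of_real (a k) / (z - of_real (t k))\<^sup>2))
    has_field_derivative D) (at z)"
proof -
  have nz: "z \<noteq> of_real (t i)" for i using assms(2) by auto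
  have "(\<lambda>z. of_real c + (\<Sum>k\<in>I. of_real (a k) / (z - of_real (t k))\<^sup>2)) field_differentiable (at z)"
    using nz by (intro derivative_intros field_differentiable_sum) auto
  then show ?thesis by (simp add: field_differentiable_def)
qed

text \<open>Multiplying |F'| and Im F by |T|^2 expresses the Laplacian through two forms. The
  numerator is then |R|, which is common to all functions with the same R, so a comparison of two
  Laplacians only involves the denominators.\<close>

lemma has_laplacian_ln_Im_nevanlinna:
  fixes t :: "'b \<Rightarrow> real"
  assumes "finite I" "Im z > 0" and pos: "pform I c a (\<lambda>i. (cmod (z - of_real (t i)))\<^sup>2) > 0"
  shows "Im (nevanlinna I c a t z) > 0"
    and "has_laplacian (\<lambda>w. ln (Im (nevanlinna I c a t w))) z
      (- (cmod (pform I (of_real c) (\<lambda>k. of_real (a k)) (\<lambda>i. (z - of_real (t i))\<^sup>2)) /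
          (Im z * pform I c a (\<lambda>i. (cmod (z - of_real (t i)))\<^sup>2)))\<^sup>2)"
proof -
  let ?P = "\<Prod>i\<in>I. (cmod (z - of_real (t i)))\<^sup>2"
  let ?F' = "\<lambda>z. of_real c + (\<Sum>k\<in>I. of_real (a k) / (z - of_real (t k))\<^sup>2)"
  have nz: "z \<noteq> of_real (t i)" for i using assms(2) by auto
  have P: "?P > 0" using nz by (intro prod_pos) auto
  have "?P * Im (nevanlinna I c a t z) > 0"
    using Im_nevanlinna[OF assms(1,2)] assms(2) pos by simp
  then show F: "Im (nevanlinna I c a t z) > 0"
    using P by (simp add: zero_less_mult_iff)
  have "pform I (of_real c) (\<lambda>k. of_real (a k)) (\<lambda>i. (z - of_real (t i))\<^sup>2) =
      (\<Prod>i\<in>I. (z - of_real (t i))\<^sup>2) * ?F' z"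
    using nz assms(1) by (subst pform_nonzero) auto
  then have "cmod (pform I (of_real c) (\<lambda>k. of_real (a k)) (\<lambda>i. (z - of_real (t i))\<^sup>2)) =
      ?P * cmod (?F' z)"
    by (simp add: norm_mult prod_norm[symmetric] norm_power)
  moreover have "Im z * pform I c a (\<lambda>i. (cmod (z - of_real (t i)))\<^sup>2) =
      ?P * Im (nevanlinna I c a t z)"
    using Im_nevanlinna[OF assms(1,2)] by simp
  ultimately have eq: "cmod (pform I (of_real c) (\<lambda>k. of_real (a k)) (\<lambda>i. (z - of_real (t i))\<^sup>2)) /
      (Im z * pform I c a (\<lambda>i. (cmod (z - of_real (t i)))\<^sup>2)) =
      cmod (?F' z) / Im (nevanlinna I c a t z)"
    using P by simp
  obtain D where D: "(?F' has_field_derivative D) (at z)"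
    using nevanlinna_second_derivative[OF assms(1,2)] by blast
  show "has_laplacian (\<lambda>w. ln (Im (nevanlinna I c a t w))) z
      (- (cmod (pform I (of_real c) (\<lambda>k. of_real (a k)) (\<lambda>i. (z - of_real (t i))\<^sup>2)) /
          (Im z * pform I c a (\<lambda>i. (cmod (z - of_real (t i)))\<^sup>2)))\<^sup>2)"
    unfolding eq
    by (rule has_laplacian_ln_Im[OF open_halfspace_Im_gt _ nevanlinna_derivative D F])
       (use assms in auto)
qed

text \<open>One weight is allowed to vanish: the product of all weights is then 0, but the summand
  that omits this weight stays positive. This makes the forms positive at the nodes themselves,
  which lie on the boundary of the half-plane.\<close>

lemma pform_pos:
  fixes w :: "'b \<Rightarrow> real"
  assumes "finite I" "I \<noteq> {}" "c \<ge> 0" "\<And>k. k \<in> I \<Longrightarrow> a k > 0" "\<And>i. i \<in> I \<Longrightarrow> w i \<ge> 0"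
    and "\<And>i j. i \<in> I \<Longrightarrow> j \<in> I \<Longrightarrow> w i = 0 \<Longrightarrow> w j = 0 \<Longrightarrow> i = j"
  shows "pform I c a w > 0"
proof -
  obtain k where k: "k \<in> I" "\<And>i. i \<in> I - {k} \<Longrightarrow> w i > 0"
  proof (cases "\<exists>k\<in>I. w k = 0")
    case True
    then obtain k where "k \<in> I" "w k = 0" by blast
    with assms(5,6) show ?thesis by (intro that[of k]) (auto simp: less_le)
  next
    case False
    with assms(2,5) show ?thesis using that by (metis DiffD1 ex_in_conv less_le)
  qed
  have nonneg: "a j * prod w (I - {j}) \<ge> 0" if "j \<in> I" for j
    using that assms(4)[of j] by (intro mult_nonneg_nonneg prod_nonneg) (auto intro: assms(5))
  have "0 < prod w (I - {k})" using k(2) by (rule prod_pos)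
  then have "0 < a k * prod w (I - {k})" using assms(4)[OF k(1)] by simp
  also have "\<dots> \<le> (\<Sum>k\<in>I. a k * prod w (I - {k}))"
    using sum_nonneg[of "I - {k}" "\<lambda>j. a j * prod w (I - {j})"] nonneg k(1) assms(1)
    by (simp add: sum.remove)
  also have "\<dots> \<le> pform I c a w"
    unfolding pform_def using assms(3) prod_nonneg[of I w] assms(5) by simp
  finally show ?thesis .
qed

lemma pform_of_real_square:
  fixes t :: "'b \<Rightarrow> real"
  shows "pform I (complex_of_real c) (\<lambda>k. of_real (a k)) (\<lambda>i. (of_real x - of_real (t i))\<^sup>2) =
    of_real (pform I c a (\<lambda>i. (x - t i)\<^sup>2))"
  by (simp add: pform_of_real[symmetric])

text \<open>Both sides are polynomials in \<open>z\<close>, and agreement on the real line gives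
  their difference infinitely many roots.\<close>

lemma pform_square_complex_eq:
  fixes t :: "'b \<Rightarrow> real" and s :: "'d \<Rightarrow> real"
  assumes "\<And>x. pform I c a (\<lambda>i. (x - t i)\<^sup>2) = pform J d b (\<lambda>i. (x - s i)\<^sup>2)"
  shows "pform I (complex_of_real c) (\<lambda>k. of_real (a k)) (\<lambda>i. (z - of_real (t i))\<^sup>2) =
    pform J (of_real d) (\<lambda>k. of_real (b k)) (\<lambda>i. (z - of_real (s i))\<^sup>2)"
proof -
  define D where "D = pform I [:complex_of_real c:] (\<lambda>k. [:of_real (a k):]) (\<lambda>i. [:- of_real (t i), 1:]\<^sup>2)
    - pform J [:complex_of_real d:] (\<lambda>k. [:of_real (b k):]) (\<lambda>i. [:- of_real (s i), 1:]\<^sup>2)"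
  have D: "poly D w = pform I (complex_of_real c) (\<lambda>k. of_real (a k)) (\<lambda>i. (w - of_real (t i))\<^sup>2) -
    pform J (of_real d) (\<lambda>k. of_real (b k)) (\<lambda>i. (w - of_real (s i))\<^sup>2)" for w
    by (simp add: D_def poly_pform)
  have "poly D (of_real x) = 0" for x
    unfolding D pform_of_real_square assms by simp
  then have "range complex_of_real \<subseteq> {w. poly D w = 0}" by auto
  moreover have "infinite (range complex_of_real)"
    by (simp add: finite_image_iff inj_def infinite_UNIV_char_0)
  ultimately have "D = 0" using poly_roots_finite finite_subset by blast
  then show ?thesis using D[of z] by simp
qed

section \<open>The maximum principle and polarization\<close>

lemma tendsto_prod_norm_ratio:
  assumes "finite J"
  shows "((\<lambda>z. (\<Prod>i\<in>J. (cmod (z - t i))\<^sup>2) / ((cmod z)\<^sup>2) ^ card J) \<longlongrightarrow> 1) at_infinity"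
proof -
  have one: "((\<lambda>z. (cmod (z - s))\<^sup>2 / (cmod z)\<^sup>2) \<longlongrightarrow> 1) at_infinity" for s
  proof -
    have "((\<lambda>z. (cmod (1 - s * inverse z))\<^sup>2) \<longlongrightarrow> (cmod (1 - s * 0))\<^sup>2) at_infinity"
      by (intro tendsto_intros tendsto_inverse_0)
    then have lim: "((\<lambda>z. (cmod (1 - s * inverse z))\<^sup>2) \<longlongrightarrow> 1) at_infinity" by simp
    have "\<forall>\<^sub>F z in at_infinity. (cmod (1 - s * inverse z))\<^sup>2 = (cmod (z - s))\<^sup>2 / (cmod z)\<^sup>2"
      unfolding eventually_at_infinity
    proof (intro exI[of _ 1] allI impI)
      fix z :: complex assume "1 \<le> cmod z"
      then have "z \<noteq> 0" by auto
      then have "1 - s * inverse z = (z - s) / z" by (simp add: field_simps)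
      then show "(cmod (1 - s * inverse z))\<^sup>2 = (cmod (z - s))\<^sup>2 / (cmod z)\<^sup>2"
        by (simp add: norm_divide power_divide)
    qed
    then show ?thesis using lim by (rule Lim_transform_eventually[rotated])
  qed
  have "((\<lambda>z. \<Prod>i\<in>J. (cmod (z - t i))\<^sup>2 / (cmod z)\<^sup>2) \<longlongrightarrow> (\<Prod>i\<in>J. 1)) at_infinity"
    by (intro tendsto_prod one)
  then show ?thesis by (simp add: prod_dividef)
qed

text \<open>Both kinds of form grow like |z|^(2m). With \<open>m\<close> nodes and
  \<open>c = 1\<close> the full product dominates; with \<open>Suc m\<close> nodes and
  \<open>c = 0\<close> each summand contributes its weight. That the weights sum to 1 in the second
  case is found only in \<open>tendsto_representation_ratio\<close>.\<close>

lemma tendsto_pform_ratio: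
  assumes "finite I" and "card I = m \<and> c = 1 \<and> A = 1 \<or> card I = Suc m \<and> c = 0 \<and> A = sum a I"
  shows "((\<lambda>z. pform I c a (\<lambda>i. (cmod (z - t i))\<^sup>2) / ((cmod z)\<^sup>2) ^ m) \<longlongrightarrow> A) at_infinity"
proof -
  let ?w = "\<lambda>z i. (cmod (z - t i))\<^sup>2"
  have split: "pform I c a (?w z) / ((cmod z)\<^sup>2) ^ m =
      c * (prod (?w z) I / ((cmod z)\<^sup>2) ^ m) +
      (\<Sum>k\<in>I. a k * (prod (?w z) (I - {k}) / ((cmod z)\<^sup>2) ^ m))" for z
    by (simp add: pform_def add_divide_distrib sum_divide_distrib)
  from assms(2) show ?thesis
  proof
    assume A: "card I = m \<and> c = 1 \<and> A = 1"
    have inv0: "((\<lambda>z::complex. inverse ((cmod z)\<^sup>2)) \<longlongrightarrow> 0) at_infinity"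
    proof -
      have "((\<lambda>z::complex. (cmod (inverse z))\<^sup>2) \<longlongrightarrow> (cmod 0)\<^sup>2) at_infinity"
        by (intro tendsto_intros tendsto_inverse_0)
      then show ?thesis by (simp add: norm_inverse power_inverse)
    qed
    have zero: "((\<lambda>z. prod (?w z) (I - {k}) / ((cmod z)\<^sup>2) ^ m) \<longlongrightarrow> 0) at_infinity" if "k \<in> I" for k
    proof -
      have m: "m = Suc (card (I - {k}))" using card_Suc_Diff1[OF assms(1) that] A by linarith
      have "((\<lambda>z. (prod (?w z) (I - {k}) / ((cmod z)\<^sup>2) ^ card (I - {k})) * inverse ((cmod z)\<^sup>2))
          \<longlongrightarrow> 1 * 0) at_infinity"
        using assms(1) by (intro tendsto_mult inv0 tendsto_prod_norm_ratio) auto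
      then show ?thesis unfolding m by (simp add: divide_inverse mult_ac)
    qed
    have "((\<lambda>z. c * (prod (?w z) I / ((cmod z)\<^sup>2) ^ m) +
      (\<Sum>k\<in>I. a k * (prod (?w z) (I - {k}) / ((cmod z)\<^sup>2) ^ m))) \<longlongrightarrow> 1 * 1 + (\<Sum>k\<in>I. a k * 0)) at_infinity"
      using A tendsto_prod_norm_ratio[OF assms(1), of t]
      by (intro tendsto_add tendsto_mult tendsto_sum zero) auto
    then show ?thesis unfolding split using A by simp
  next
    assume A: "card I = Suc m \<and> c = 0 \<and> A = sum a I"
    have one: "((\<lambda>z. prod (?w z) (I - {k}) / ((cmod z)\<^sup>2) ^ m) \<longlongrightarrow> 1) at_infinity" if "k \<in> I" for k
    proof -
      have m: "m = card (I - {k})" using card_Suc_Diff1[OF assms(1) that] A by linarith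
      show ?thesis unfolding m using assms(1) by (intro tendsto_prod_norm_ratio) auto
    qed
    have "((\<lambda>z. (\<Sum>k\<in>I. a k * (prod (?w z) (I - {k}) / ((cmod z)\<^sup>2) ^ m))) \<longlongrightarrow> (\<Sum>k\<in>I. a k * 1)) at_infinity"
      by (intro tendsto_mult tendsto_sum one tendsto_const)
    then show ?thesis unfolding split using A by simp
  qed
qed

lemma continuous_on_pform:
  assumes "\<And>i. i \<in> I \<Longrightarrow> continuous_on S (\<lambda>z. w z i :: real)"
  shows "continuous_on S (\<lambda>z. pform I c a (w z))"
  unfolding pform_def by (intro continuous_intros) (auto intro: assms)

lemma pform_norm_pos:
  fixes t :: "'b \<Rightarrow> real"
  assumes "finite I" "I \<noteq> {}" "inj_on t I" "c \<ge> 0" "\<And>k. k \<in> I \<Longrightarrow> a k > 0"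
  shows "pform I c a (\<lambda>i. (cmod (z - of_real (t i)))\<^sup>2) > 0"
  using assms by (intro pform_pos) (auto simp: inj_on_def)

lemma pform_norm_of_real:
  fixes t :: "'b \<Rightarrow> real"
  assumes "Im z = 0"
  shows "pform I c a (\<lambda>i. (cmod (z - of_real (t i)))\<^sup>2) = pform I c a (\<lambda>i. (Re z - t i)\<^sup>2)"
  using assms by (simp add: cmod_power2)

text \<open>
  The logarithm of the quotient of the two forms vanishes on the boundary of the half-plane.
  Since \<open>log Im F\<close> has Laplacian \<open>- \<bar>F'\<bar>\<^sup>2 / (Im F)\<^sup>2\<close> and both \<open>F'\<close> have the same numerator, this
  logarithm is subharmonic where it is positive; \<open>exp (- Im z)\<close> makes it strictly so.
\<close>

lemma pform_norm_le:
  fixes t :: "'b \<Rightarrow> real" and s :: "'d \<Rightarrow> real"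
  assumes fin: "finite I" "finite J" and ne: "I \<noteq> {}" "J \<noteq> {}" and inj: "inj_on t I" "inj_on s J"
    and cd: "c \<ge> 0" "d \<ge> 0" and a: "\<And>k. k \<in> I \<Longrightarrow> a k > 0" and b: "\<And>k. k \<in> J \<Longrightarrow> b k > 0"
    and eq: "\<And>x. pform I c a (\<lambda>i. (x - t i)\<^sup>2) = pform J d b (\<lambda>i. (x - s i)\<^sup>2)"
    and lim: "((\<lambda>z. pform I c a (\<lambda>i. (cmod (z - of_real (t i)))\<^sup>2) /
      pform J d b (\<lambda>i. (cmod (z - of_real (s i)))\<^sup>2)) \<longlongrightarrow> 1) at_infinity"
    and z: "Im z > 0"
  shows "pform I c a (\<lambda>i. (cmod (z - of_real (t i)))\<^sup>2) \<le> pform J d b (\<lambda>i. (cmod (z - of_real (s i)))\<^sup>2)"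
proof (rule ccontr)
  define K where "K z = pform I c a (\<lambda>i. (cmod (z - of_real (t i)))\<^sup>2)" for z
  define L where "L z = pform J d b (\<lambda>i. (cmod (z - of_real (s i)))\<^sup>2)" for z
  define h where "h z = ln (K z) - ln (L z)" for z
  have K: "K z > 0" for z unfolding K_def by (rule pform_norm_pos[OF fin(1) ne(1) inj(1) cd(1) a])
  have L: "L z > 0" for z unfolding L_def by (rule pform_norm_pos[OF fin(2) ne(2) inj(2) cd(2) b])
  assume "\<not> ?thesis"
  then have "K z > L z" by (simp add: K_def L_def)
  then have hz: "h z > 0" using K L by (simp add: h_def)
  \<comment> \<open>With this \<open>e\<close> the value \<open>v z\<close> exceeds
    \<open>2 * e\<close>, whereas \<open>v\<close> is at most \<open>e\<close> on the real axis and
    below \<open>2 * e\<close> far away. Hence the maximum of \<open>v\<close> is attained in the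
    open half-plane.\<close>
  define e where "e = h z / 2"
  have e: "e > 0" using hz by (simp add: e_def)
  define v where "v w = h w + e * exp (- Im w)" for w
  have v_le: "v w \<le> h w + e" if "Im w \<ge> 0" for w using that e by (simp add: v_def)
  have vz: "v z > 2 * e" using e by (simp add: v_def e_def)
  have "((\<lambda>w. ln (K w / L w)) \<longlongrightarrow> ln 1) at_infinity"
    unfolding K_def L_def by (intro tendsto_ln lim) auto
  moreover have "ln (K w / L w) = h w" for w
    using K[of w] L[of w] by (simp add: h_def ln_div)
  ultimately have "((\<lambda>w. h w) \<longlongrightarrow> 0) at_infinity" by simp
  then have "\<forall>\<^sub>F w in at_infinity. h w < e" using e by (rule order_tendstoD)
  then obtain M where M: "\<And>w. cmod w \<ge> M \<Longrightarrow> h w < e" by (auto simp: eventually_at_infinity)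
  define C where "C = cball 0 M \<inter> {w. Im w \<ge> 0}"
  have "compact C"
    unfolding C_def by (intro compact_Int_closed compact_cball closed_halfspace_Im_ge)
  have small: "v w < 2 * e" if "Im w \<ge> 0" "cmod w \<ge> M" for w
    using v_le[OF that(1)] M[OF that(2)] by simp
  have zC: "z \<in> C" using small[of z] vz z by (force simp: C_def)
  have "continuous_on C v"
    unfolding v_def h_def K_def L_def
    by (intro continuous_intros continuous_on_pform) (use K L in \<open>auto simp: K_def L_def less_imp_neq[symmetric]\<close>)
  then obtain w where w: "w \<in> C" "\<And>u. u \<in> C \<Longrightarrow> v u \<le> v w"
    using continuous_attains_sup[OF \<open>compact C\<close>] zC by blast
  have vw: "v w > 2 * e" using w(2)[OF zC] vz by simp
  have "Im w \<noteq> 0"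
  proof
    assume "Im w = 0"
    \<comment> \<open>For real \<open>w\<close> the squared moduli are plain squares, so both forms
      reduce to the polynomials that \<open>eq\<close> identifies.\<close>
    then have "h w = 0" using eq by (simp add: h_def K_def L_def pform_norm_of_real)
    then show False using v_le[of w] vw \<open>Im w = 0\<close> e by simp
  qed
  then have Imw: "Im w > 0" using w(1) by (simp add: C_def)
  have wM: "cmod w < M" using small[of w] vw Imw by force
  have nearby: "\<forall>\<^sub>F u in nhds w. Im u > 0 \<and> u \<in> C"
  proof -
    have "\<forall>\<^sub>F u in nhds w. u \<in> ball 0 M \<inter> {u. Im u > 0}"
      using wM Imw by (intro eventually_nhds_in_open open_Int open_halfspace_Im_gt open_ball) auto
    then show ?thesis by eventually_elim (auto simp: C_def)
  qed
  \<comment> \<open>This is \<open>v\<close> rewritten by \<open>Im_nevanlinna\<close>. The two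
    terms \<open>ln (Im u)\<close> cancel, and every remaining summand has a known
    Laplacian.\<close>
  define g where "g u = (\<Sum>i\<in>I. ln ((cmod (u - of_real (t i)))\<^sup>2)) - (\<Sum>i\<in>J. ln ((cmod (u - of_real (s i)))\<^sup>2))
      + (ln (Im (nevanlinna I c a t u)) - ln (Im (nevanlinna J d b s u))) + e * exp (- Im u)" for u
  have nz: "u \<noteq> of_real x" if "Im u > 0" for u x using that by auto
  have vg: "v u = g u" if "Im u > 0" for u
  proof -
    have lnprod: "ln p + ln f = ln y + ln k" if "p * f = y * k" "p > 0" "f > 0" "y > 0" "k > 0"
      for p f y k :: real
      using that by (metis ln_mult_pos)
    have "ln (\<Prod>i\<in>I. (cmod (u - of_real (t i)))\<^sup>2) + ln (Im (nevanlinna I c a t u)) = ln (Im u) + ln (K u)"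
      by (rule lnprod) (use Im_nevanlinna[OF fin(1) that, of t c a] that K[of u] nz[OF that]
        has_laplacian_ln_Im_nevanlinna(1)[OF fin(1) that, of c a t] in \<open>auto simp: K_def intro!: prod_pos\<close>)
    moreover have "ln (\<Prod>i\<in>J. (cmod (u - of_real (s i)))\<^sup>2) + ln (Im (nevanlinna J d b s u)) = ln (Im u) + ln (L u)"
      by (rule lnprod) (use Im_nevanlinna[OF fin(2) that, of s d b] that L[of u] nz[OF that]
        has_laplacian_ln_Im_nevanlinna(1)[OF fin(2) that, of d b s] in \<open>auto simp: L_def intro!: prod_pos\<close>)
    moreover have "ln (\<Prod>i\<in>I. (cmod (u - of_real (t i)))\<^sup>2) = (\<Sum>i\<in>I. ln ((cmod (u - of_real (t i)))\<^sup>2))"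
      "ln (\<Prod>i\<in>J. (cmod (u - of_real (s i)))\<^sup>2) = (\<Sum>i\<in>J. ln ((cmod (u - of_real (s i)))\<^sup>2))"
      using nz[OF that] fin by (auto intro!: ln_prod)
    ultimately show ?thesis unfolding v_def g_def h_def by linarith
  qed
  define R where "R = cmod (pform I (complex_of_real c) (\<lambda>k. of_real (a k)) (\<lambda>i. (w - of_real (t i))\<^sup>2))"
  have R': "R = cmod (pform J (complex_of_real d) (\<lambda>k. of_real (b k)) (\<lambda>i. (w - of_real (s i))\<^sup>2))"
    unfolding R_def by (rule arg_cong[OF pform_square_complex_eq[OF eq]])
  have "has_laplacian g w ((\<Sum>i\<in>I. 0) - (\<Sum>i\<in>J. 0) +
      (- (R / (Im w * K w))\<^sup>2 - (- (R / (Im w * L w))\<^sup>2)) + e * exp (- Im w))"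
    unfolding g_def
  proof (intro has_laplacian_add has_laplacian_diff has_laplacian_sum has_laplacian_cmult
      has_laplacian_ln_norm has_laplacian_exp_Im nz Imw)
    show "has_laplacian (\<lambda>w. ln (Im (nevanlinna I c a t w))) w (- (R / (Im w * K w))\<^sup>2)"
      unfolding R_def K_def by (rule has_laplacian_ln_Im_nevanlinna[OF fin(1) Imw K[unfolded K_def]])
    show "has_laplacian (\<lambda>w. ln (Im (nevanlinna J d b s w))) w (- (R / (Im w * L w))\<^sup>2)"
      unfolding R' L_def by (rule has_laplacian_ln_Im_nevanlinna[OF fin(2) Imw L[unfolded L_def]])
  qed
  moreover have "\<forall>\<^sub>F u in nhds w. g u \<le> g w"
    using nearby by eventually_elim (use w(2) vg Imw in force)
  ultimately have "- (R / (Im w * K w))\<^sup>2 + (R / (Im w * L w))\<^sup>2 + e * exp (- Im w) \<le> 0"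
    using has_laplacian_local_max by fastforce
  \<comment> \<open>At the maximum \<open>h w\<close> is still positive, so \<open>K w\<close>
    exceeds \<open>L w\<close> and the Laplacian of \<open>h\<close> is nonnegative. The exponential
    term then makes the total strictly positive, which is impossible at a local maximum.\<close>
  moreover have "(R / (Im w * K w))\<^sup>2 \<le> (R / (Im w * L w))\<^sup>2"
  proof -
    have "h w > 0" using v_le[of w] vw Imw e by simp
    then have "L w < K w" using K L by (simp add: h_def)
    then show ?thesis
      using Imw L[of w] K[of w] by (intro power_mono divide_left_mono mult_left_mono) (auto simp: R_def)
  qed
  moreover have "e * exp (- Im w) > 0" using e by simp
  ultimately show False by linarith
qed

text \<open>Polarization: substitute \<open>q = - v\<^sup>2\<close> in the polynomial \<open>q \<mapsto> pform I c a ((x - t i)\<^sup>2 + q)\<close>.\<close>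

lemma pform_polarize:
  fixes t :: "'b \<Rightarrow> real" and s :: "'d \<Rightarrow> real"
  assumes "\<And>z. Im z > 0 \<Longrightarrow> pform I c a (\<lambda>i. (cmod (z - of_real (t i)))\<^sup>2) =
      pform J d b (\<lambda>i. (cmod (z - of_real (s i)))\<^sup>2)"
  shows "pform I c a (\<lambda>i. (x - t i) * (y - t i)) = pform J d b (\<lambda>i. (x - s i) * (y - s i))"
proof -
  define u where "u = (x + y) / 2"
  define v where "v = (x - y) / 2"
  define D where "D = pform I [:c:] (\<lambda>k. [:a k:]) (\<lambda>i. [:(u - t i)\<^sup>2, 1:]) -
    pform J [:d:] (\<lambda>k. [:b k:]) (\<lambda>i. [:(u - s i)\<^sup>2, 1:])"
  have D: "poly D q = pform I c a (\<lambda>i. (u - t i)\<^sup>2 + q) - pform J d b (\<lambda>i. (u - s i)\<^sup>2 + q)" for q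
    by (simp add: D_def poly_pform)
  \<comment> \<open>Every positive \<open>q\<close> is the square of a height above the real point
    \<open>u\<close>, so the half-plane supplies infinitely many roots of \<open>D\<close>.\<close>
  have "poly D q = 0" if "q > 0" for q
    using assms[of "Complex u (sqrt q)"] that by (simp add: D cmod_power2)
  then have "{0<..} \<subseteq> {q. poly D q = 0}" by auto
  moreover have "infinite {0::real<..}" by (rule infinite_Ioi)
  ultimately have "D = 0" using poly_roots_finite finite_subset by blast
  moreover have "(u - r)\<^sup>2 + - v\<^sup>2 = (x - r) * (y - r)" for r
    by (simp add: u_def v_def power2_eq_square field_simps)
  ultimately show ?thesis using D[of "- v\<^sup>2"] by simp
qed

section \<open>Stieltjes systems\<close>

text \<open>The R of the overview, assembled from its real quadratic factors so that the residue
  argument takes place over the reals.\<close>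

definition zero_poly :: "nat \<Rightarrow> (nat \<Rightarrow> complex) \<Rightarrow> real poly" where
  "zero_poly m \<zeta> = (\<Prod>j=1..m. [:(cmod (\<zeta> j))\<^sup>2, - 2 * Re (\<zeta> j), 1:])"

lemma poly_zero_poly: "poly (zero_poly m \<zeta>) u = (\<Prod>j=1..m. (cmod (of_real u - \<zeta> j))\<^sup>2)"
  unfolding zero_poly_def poly_prod
  by (intro prod.cong refl) (simp add: cmod_power2, simp add: power2_eq_square algebra_simps)

lemma degree_zero_poly: "degree (zero_poly m \<zeta>) = 2 * m"
  unfolding zero_poly_def by (subst degree_prod_eq_sum_degree) auto

lemma lead_coeff_zero_poly: "coeff (zero_poly m \<zeta>) (2 * m) = 1"
proof -
  have "lead_coeff (zero_poly m \<zeta>) = 1"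
    unfolding zero_poly_def by (subst lead_coeff_prod) simp
  then show ?thesis by (simp add: degree_zero_poly)
qed

lemma poly_zero_poly_pos:
  assumes "\<forall>j\<in>{1..m}. Im (\<zeta> j) > 0"
  shows "poly (zero_poly m \<zeta>) u > 0"
  unfolding poly_zero_poly
proof (intro prod_pos ballI)
  fix j assume "j \<in> {1..m}"
  then have "of_real u \<noteq> \<zeta> j" using assms by (metis Im_complex_of_real less_irrefl)
  then show "0 < (cmod (of_real u - \<zeta> j))\<^sup>2" by simp
qed

lemma poly_pderiv_zero_poly:
  assumes "\<forall>j\<in>{1..m}. Im (\<zeta> j) > 0"
  shows "poly (pderiv (zero_poly m \<zeta>)) u =
    poly (zero_poly m \<zeta>) u * (\<Sum>j=1..m. 2 * (u - Re (\<zeta> j)) / (cmod (of_real u - \<zeta> j))\<^sup>2)"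
proof -
  have p: "poly [:(cmod (\<zeta> j))\<^sup>2, - 2 * Re (\<zeta> j), 1:] u = (cmod (of_real u - \<zeta> j))\<^sup>2" for j
    by (simp add: cmod_power2) (simp add: power2_eq_square algebra_simps)
  have nz: "of_real u \<noteq> \<zeta> j" if "j \<in> {1..m}" for j using assms that by (metis Im_complex_of_real less_irrefl)
  have "poly (pderiv (zero_poly m \<zeta>)) u = poly (zero_poly m \<zeta>) u *
      (\<Sum>j=1..m. poly (pderiv [:(cmod (\<zeta> j))\<^sup>2, - 2 * Re (\<zeta> j), 1:]) u /
        poly [:(cmod (\<zeta> j))\<^sup>2, - 2 * Re (\<zeta> j), 1:] u)"
    unfolding zero_poly_def by (rule poly_pderiv_prod) (use nz in \<open>auto simp only: p\<close>, simp_all)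
  also have "\<dots> = poly (zero_poly m \<zeta>) u * (\<Sum>j=1..m. 2 * (u - Re (\<zeta> j)) / (cmod (of_real u - \<zeta> j))\<^sup>2)"
    unfolding p by (simp add: pderiv_pCons algebra_simps)
  finally show ?thesis .
qed

lemma conjugate_pair_fraction:
  "1 / (complex_of_real u - z) + 1 / (complex_of_real u - cnj z) =
   of_real (2 * (u - Re z) / (cmod (of_real u - z))\<^sup>2)"
proof (cases "of_real u = z")
  case True
  then show ?thesis by auto
next
  case False
  then have "of_real u \<noteq> cnj z" by (metis complex_cnj_cnj complex_cnj_complex_of_real)
  then have "1 / (complex_of_real u - z) + 1 / (complex_of_real u - cnj z) =
      (2 * of_real u - (z + cnj z)) / ((of_real u - z) * (of_real u - cnj z))"
    using False by (simp add: field_simps)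
  also have "(of_real u - z) * (of_real u - cnj z) = of_real ((cmod (of_real u - z))\<^sup>2)"
    by (metis complex_cnj_complex_of_real complex_cnj_diff complex_norm_square)
  also have "2 * of_real u - (z + cnj z) = of_real (2 * (u - Re z))"
    by (simp add: complex_add_cnj)
  finally show ?thesis by simp
qed

lemma stieltjes_system_real_iff:
  "stieltjes_system N m \<zeta> x \<longleftrightarrow> inj_on x {1..N} \<and> (\<forall>k\<in>{1..N}.
    (\<Sum>j\<in>{1..N} - {k}. 2 / (x k - x j)) =
    (\<Sum>j=1..m. 2 * (x k - Re (\<zeta> j)) / (cmod (of_real (x k) - \<zeta> j))\<^sup>2))"
proof -
  have "(\<Sum>j\<in>{1..N} - {k}. 2 / (complex_of_real (x k) - complex_of_real (x j)))
        - (\<Sum>j=1..m. 1 / (complex_of_real (x k) - \<zeta> j) + 1 / (complex_of_real (x k) - cnj (\<zeta> j))) =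
      of_real ((\<Sum>j\<in>{1..N} - {k}. 2 / (x k - x j)) -
        (\<Sum>j=1..m. 2 * (x k - Re (\<zeta> j)) / (cmod (of_real (x k) - \<zeta> j))\<^sup>2))" for k
    unfolding conjugate_pair_fraction by (simp add: of_real_sum)
  then show ?thesis
    unfolding stieltjes_system_def by (simp only: of_real_eq_0_iff right_minus_eq)
qed

text \<open>The sum over the \<zeta> j is the logarithmic derivative of R at \<open>x k\<close>.
  Since R is positive on the real line, multiplying the equation by it loses nothing.\<close>

lemma stieltjes_system_poly_iff:
  assumes "\<forall>j\<in>{1..m}. Im (\<zeta> j) > 0"
  shows "stieltjes_system N m \<zeta> x \<longleftrightarrow> inj_on x {1..N} \<and> (\<forall>k\<in>{1..N}.
    poly (pderiv (zero_poly m \<zeta>)) (x k) =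
    poly (zero_poly m \<zeta>) (x k) * (\<Sum>j\<in>{1..N} - {k}. 2 / (x k - x j)))"
proof -
  have nz: "poly (zero_poly m \<zeta>) u \<noteq> 0" for u using poly_zero_poly_pos[OF assms] by (metis less_irrefl)
  have cancel: "A = B \<longleftrightarrow> poly (zero_poly m \<zeta>) u * B = poly (zero_poly m \<zeta>) u * A" for A B u
    using nz[of u] by auto
  show ?thesis
    unfolding stieltjes_system_real_iff poly_pderiv_zero_poly[OF assms]
    by (intro conj_cong ball_cong refl cancel)
qed

text \<open>The coefficient of (z - x k)^(-2) in the partial fractions of R / T^2, that is, the a k
  of the overview.\<close>

definition residue_weight :: "nat \<Rightarrow> nat \<Rightarrow> (nat \<Rightarrow> complex) \<Rightarrow> (nat \<Rightarrow> real) \<Rightarrow> nat \<Rightarrow> real" where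
  "residue_weight N m \<zeta> x k = poly (zero_poly m \<zeta>) (x k) / (\<Prod>j\<in>{1..N} - {k}. x k - x j)\<^sup>2"

lemma residue_weight_pos:
  assumes "\<forall>j\<in>{1..m}. Im (\<zeta> j) > 0" "inj_on x {1..N}" "k \<in> {1..N}"
  shows "residue_weight N m \<zeta> x k > 0"
proof -
  have "x k - x j \<noteq> 0" if "j \<in> {1..N} - {k}" for j
    using that assms(3) inj_onD[OF assms(2), of k j] by auto
  then have "(\<Prod>j\<in>{1..N} - {k}. x k - x j) \<noteq> 0" by (subst prod_zero_iff) auto
  then show ?thesis
    unfolding residue_weight_def using poly_zero_poly_pos[OF assms(1)] by simp
qed

text \<open>With \<open>m\<close> nodes, R and T^2 are both monic of degree 2m, and
  \<open>c = 1\<close> cancels their leading terms. With \<open>Suc m\<close> nodes the degree of R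
  is already below that of T^2, which leaves \<open>c = 0\<close>.\<close>

lemma zero_poly_representation:
  assumes \<zeta>: "\<forall>j\<in>{1..m}. Im (\<zeta> j) > 0" and sys: "stieltjes_system N m \<zeta> x"
    and N: "N = m \<and> c = 1 \<or> N = Suc m \<and> c = 0" and "m > 0"
  shows "poly (zero_poly m \<zeta>) z = pform {1..N} c (residue_weight N m \<zeta> x) (\<lambda>i. (z - x i)\<^sup>2)"
proof (rule pform_representation)
  show "inj_on x {1..N}" using sys by (simp add: stieltjes_system_def)
  show "degree (zero_poly m \<zeta> - smult c ((node_poly {1..N} x)\<^sup>2)) < 2 * card {1..N}"
    using N
  proof
    assume N: "N = m \<and> c = 1"
    let ?D = "zero_poly m \<zeta> - (node_poly {1..m} x)\<^sup>2"
    have deg: "degree ((node_poly {1..m} x)\<^sup>2) = 2 * m"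
      by (simp add: degree_power_eq node_poly_nonzero degree_node_poly)
    have "lead_coeff ((node_poly {1..m} x)\<^sup>2) = 1"
      using coeff_node_poly[of "{1..m}" x] by (simp add: lead_coeff_power degree_node_poly)
    then have "coeff ((node_poly {1..m} x)\<^sup>2) (2 * m) = 1" using deg by simp
    then have "coeff ?D (2 * m) = 0" by (simp add: lead_coeff_zero_poly)
    moreover have "degree ?D \<le> 2 * m" using deg by (intro degree_diff_le) (auto simp: degree_zero_poly)
    ultimately have "degree ?D < 2 * m"
      using \<open>m > 0\<close> by (metis degree_0 leading_coeff_0_iff le_neq_implies_less mult_pos_pos pos2)
    then show ?thesis using N by simp
  qed (simp add: degree_zero_poly)
next
  show "poly (pderiv (zero_poly m \<zeta>)) (x k) = poly (zero_poly m \<zeta>) (x k) *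
      (\<Sum>j\<in>{1..N} - {k}. 2 / (x k - x j))" if "k \<in> {1..N}" for k
    using sys that unfolding stieltjes_system_poly_iff[OF \<zeta>] by blast
qed (simp_all only: finite_atLeastAtMost residue_weight_def)

text \<open>A limit exists by \<open>tendsto_pform_ratio\<close>, so it may be computed along the
  real axis. There the form is R, which is monic of degree 2m. For \<open>Suc m\<close> nodes this
  yields that the residue weights sum to 1.\<close>

lemma tendsto_representation_ratio:
  assumes \<zeta>: "\<forall>j\<in>{1..m}. Im (\<zeta> j) > 0" and sys: "stieltjes_system N m \<zeta> x"
    and N: "N = m \<and> c = 1 \<or> N = Suc m \<and> c = 0" and "m > 0"
  shows "((\<lambda>z. pform {1..N} c (residue_weight N m \<zeta> x) (\<lambda>i. (cmod (z - of_real (x i)))\<^sup>2) /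
    ((cmod z)\<^sup>2) ^ m) \<longlongrightarrow> 1) at_infinity"
proof -
  let ?a = "residue_weight N m \<zeta> x"
  let ?K = "\<lambda>z. pform {1..N} c ?a (\<lambda>i. (cmod (z - of_real (x i)))\<^sup>2) / ((cmod z)\<^sup>2) ^ m"
  obtain A where A: "(?K \<longlongrightarrow> A) at_infinity"
    using tendsto_pform_ratio[of "{1..N}" m c 1 ?a "\<lambda>i. of_real (x i)"]
      tendsto_pform_ratio[of "{1..N}" m c "sum ?a {1..N}" ?a "\<lambda>i. of_real (x i)"] N by auto
  have real: "filterlim complex_of_real at_infinity at_top"
    using filterlim_of_real_at_infinity by blast
  have "?K (complex_of_real u) =
      (\<Prod>j\<in>{1..m}. (cmod (complex_of_real u - \<zeta> j))\<^sup>2) / ((cmod (of_real u))\<^sup>2) ^ card {1..m}" for u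
    using zero_poly_representation[OF assms, of u]
    by (simp add: pform_norm_of_real poly_zero_poly)
  then have "((\<lambda>u. ?K (complex_of_real u)) \<longlongrightarrow> 1) at_top"
    using filterlim_compose[OF tendsto_prod_norm_ratio[of "{1..m}" \<zeta>] real] by (simp only: finite_atLeastAtMost)
  with filterlim_compose[OF A real] have "A = 1"
    by (rule tendsto_unique[OF trivial_limit_at_top_linorder])
  then show ?thesis using A by simp
qed

text \<open>The two systems may have different numbers of nodes. Equal numbers \<open>m\<close>
  serve the uniqueness in (i); \<open>m\<close> against \<open>Suc m\<close> serves the description
  of the solutions in (ii). The comparison \<open>pform_norm_le\<close> is applied in both
  directions.\<close>

lemma bezoutian_unique:
  assumes \<zeta>: "\<forall>j\<in>{1..m}. Im (\<zeta> j) > 0" and m: "m > 0"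
    and x: "stieltjes_system N m \<zeta> x" "N = m \<and> c = 1 \<or> N = Suc m \<and> c = 0"
    and y: "stieltjes_system M m \<zeta> y" "M = m \<and> d = 1 \<or> M = Suc m \<and> d = 0"
  shows "pform {1..N} c (residue_weight N m \<zeta> x) (\<lambda>i. (u - x i) * (v - x i)) =
    pform {1..M} d (residue_weight M m \<zeta> y) (\<lambda>i. (u - y i) * (v - y i))"
proof -
  have le: "pform {1..N} c (residue_weight N m \<zeta> x) (\<lambda>i. (cmod (z - of_real (x i)))\<^sup>2) \<le>
      pform {1..M} d (residue_weight M m \<zeta> y) (\<lambda>i. (cmod (z - of_real (y i)))\<^sup>2)"
    if x: "stieltjes_system N m \<zeta> x" "N = m \<and> c = 1 \<or> N = Suc m \<and> c = 0"
      and y: "stieltjes_system M m \<zeta> y" "M = m \<and> d = 1 \<or> M = Suc m \<and> d = 0"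
      and z: "Im z > 0" for N M x y c d z
  proof -
    let ?K = "\<lambda>z. pform {1..N} c (residue_weight N m \<zeta> x) (\<lambda>i. (cmod (z - of_real (x i)))\<^sup>2)"
    let ?L = "\<lambda>z. pform {1..M} d (residue_weight M m \<zeta> y) (\<lambda>i. (cmod (z - of_real (y i)))\<^sup>2)"
    have inj: "inj_on x {1..N}" "inj_on y {1..M}"
      using x(1) y(1) by (auto simp: stieltjes_system_def)
    have "((\<lambda>z. (?K z / ((cmod z)\<^sup>2) ^ m) / (?L z / ((cmod z)\<^sup>2) ^ m)) \<longlongrightarrow> 1 / 1) at_infinity"
      using tendsto_representation_ratio[OF \<zeta> x m] tendsto_representation_ratio[OF \<zeta> y m]
      by (intro tendsto_divide) auto
    moreover have "\<forall>\<^sub>F z in at_infinity. (?K z / ((cmod z)\<^sup>2) ^ m) / (?L z / ((cmod z)\<^sup>2) ^ m) = ?K z / ?L z"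
      unfolding eventually_at_infinity
    proof (intro exI[of _ 1] allI impI)
      fix z :: complex assume "1 \<le> cmod z"
      then have "((cmod z)\<^sup>2) ^ m \<noteq> 0" by auto
      then show "(?K z / ((cmod z)\<^sup>2) ^ m) / (?L z / ((cmod z)\<^sup>2) ^ m) = ?K z / ?L z" by simp
    qed
    ultimately have lim: "((\<lambda>z. ?K z / ?L z) \<longlongrightarrow> 1) at_infinity"
      using Lim_transform_eventually by fastforce
    show ?thesis
    proof (rule pform_norm_le[OF _ _ _ _ inj])
      fix r show "pform {1..N} c (residue_weight N m \<zeta> x) (\<lambda>i. (r - x i)\<^sup>2) =
          pform {1..M} d (residue_weight M m \<zeta> y) (\<lambda>i. (r - y i)\<^sup>2)"
        using zero_poly_representation[OF \<zeta> x m, of r] zero_poly_representation[OF \<zeta> y m, of r] by simp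
      show "residue_weight N m \<zeta> x k > 0" if "k \<in> {1..N}" for k
        by (rule residue_weight_pos[OF \<zeta> inj(1) that])
      show "residue_weight M m \<zeta> y k > 0" if "k \<in> {1..M}" for k
        by (rule residue_weight_pos[OF \<zeta> inj(2) that])
    qed (use x(2) y(2) m z lim in auto)
  qed
  show ?thesis
    by (rule pform_polarize, rule antisym) (rule le[OF x y], assumption, rule le[OF y x], assumption)
qed

text \<open>With one argument fixed at \<open>s k\<close>, the Bezoutians of \<open>t\<close> and
  \<open>s\<close> are the same polynomial in the other. Their coefficients of degree
  \<open>m\<close> are the two node polynomials at \<open>s k\<close>, and that of \<open>s\<close>
  vanishes there, so \<open>s k\<close> is one of the \<open>t i\<close>.\<close>

lemma stieltjes_system_unique:
  assumes \<zeta>: "\<forall>j\<in>{1..m}. Im (\<zeta> j) > 0" and m: "m > 0"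
    and t: "stieltjes_system m m \<zeta> t" and s: "stieltjes_system m m \<zeta> s"
  shows "s ` {1..m} = t ` {1..m}"
proof -
  have inj: "inj_on t {1..m}" "inj_on s {1..m}" using s t by (auto simp: stieltjes_system_def)
  have "s k \<in> t ` {1..m}" if k: "k \<in> {1..m}" for k
  proof -
    define P where "P x = pform {1..m} [:1:] (\<lambda>k. [:residue_weight m m \<zeta> x k:])
      (\<lambda>i. smult (s k - x i) [:- x i, 1:])" for x
    have "poly (P t) u = poly (P s) u" for u
      using bezoutian_unique[OF \<zeta> m t _ s, of 1 1 u "s k"]
      by (simp add: P_def poly_pform algebra_simps)
    then have "P t = P s" by (simp add: poly_eq_poly_eq_iff[symmetric] fun_eq_iff)
    then have "poly (node_poly {1..m} t) (s k) = poly (node_poly {1..m} s) (s k)"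
      using coeff_pform_bezout[of "{1..m}" 1 "residue_weight m m \<zeta> t" "s k" t]
        coeff_pform_bezout[of "{1..m}" 1 "residue_weight m m \<zeta> s" "s k" s]
      by (simp add: P_def)
    also have "\<dots> = 0" using k by (auto simp: poly_node_poly)
    finally have "\<exists>i\<in>{1..m}. s k - t i = 0" unfolding poly_node_poly by (simp only: prod_zero_iff finite_atLeastAtMost)
    then show ?thesis by auto
  qed
  then have "s ` {1..m} \<subseteq> t ` {1..m}" by blast
  then show ?thesis
    using inj by (intro card_subset_eq) (auto simp: card_image)
qed

section \<open>Solutions with one more node as level sets\<close>

text \<open>The function F belonging to the nodes \<open>t\<close>, with \<open>c = 1\<close>,
  restricted to the real line.\<close>

definition level :: "nat \<Rightarrow> (nat \<Rightarrow> complex) \<Rightarrow> (nat \<Rightarrow> real) \<Rightarrow> real \<Rightarrow> real" where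
  "level m \<zeta> t u = u - (\<Sum>k=1..m. residue_weight m m \<zeta> t k / (u - t k))"

lemma bezoutian_level:
  assumes "u \<notin> t ` {1..m}" "v \<notin> t ` {1..m}"
  shows "(u - v) * pform {1..m} 1 (residue_weight m m \<zeta> t) (\<lambda>i. (u - t i) * (v - t i)) =
    (\<Prod>i=1..m. (u - t i) * (v - t i)) * (level m \<zeta> t u - level m \<zeta> t v)"
proof -
  let ?a = "residue_weight m m \<zeta> t"
  have nz: "u - t i \<noteq> 0" "v - t i \<noteq> 0" if "i \<in> {1..m}" for i using assms that by auto
  have "level m \<zeta> t u - level m \<zeta> t v = (u - v) + (\<Sum>k=1..m. ?a k / (v - t k) - ?a k / (u - t k))"
    by (simp add: level_def sum_subtractf)
  also have "(\<Sum>k=1..m. ?a k / (v - t k) - ?a k / (u - t k)) =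
      (\<Sum>k=1..m. (u - v) * (?a k / ((u - t k) * (v - t k))))"
    using nz by (intro sum.cong refl) (simp add: field_simps)
  finally have "level m \<zeta> t u - level m \<zeta> t v = (u - v) * (1 + (\<Sum>k=1..m. ?a k / ((u - t k) * (v - t k))))"
    by (simp add: sum_distrib_left distrib_left)
  moreover have "pform {1..m} 1 ?a (\<lambda>i. (u - t i) * (v - t i)) =
      (\<Prod>i=1..m. (u - t i) * (v - t i)) * (1 + (\<Sum>k=1..m. ?a k / ((u - t k) * (v - t k))))"
    using nz by (intro pform_nonzero) auto
  ultimately show ?thesis by simp
qed

text \<open>The Bezoutian built from \<open>x\<close> has \<open>c = 0\<close>. At its own node
  \<open>x j\<close> only one summand survives, and this summand contains the factor
  \<open>x k - x k\<close>. Built from \<open>t\<close>, the same Bezoutian is the difference of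
  levels up to nonzero factors.\<close>

lemma stieltjes_system_level:
  assumes \<zeta>: "\<forall>j\<in>{1..m}. Im (\<zeta> j) > 0" and m: "m > 0"
    and t: "stieltjes_system m m \<zeta> t" and x: "stieltjes_system (Suc m) m \<zeta> x"
    and nt: "\<And>k. k \<in> {1..Suc m} \<Longrightarrow> x k \<notin> t ` {1..m}"
    and jk: "j \<in> {1..Suc m}" "k \<in> {1..Suc m}"
  shows "level m \<zeta> t (x j) = level m \<zeta> t (x k)"
proof (cases "j = k")
  case False
  have "pform {1..m} 1 (residue_weight m m \<zeta> t) (\<lambda>i. (x j - t i) * (x k - t i)) =
      pform {1..Suc m} 0 (residue_weight (Suc m) m \<zeta> x) (\<lambda>i. (x j - x i) * (x k - x i))"
    by (rule bezoutian_unique[OF \<zeta> m t _ x]) auto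
  also have "\<dots> = residue_weight (Suc m) m \<zeta> x j * (\<Prod>i\<in>{1..Suc m} - {j}. (x j - x i) * (x k - x i))"
    using jk by (intro pform_at_zero) auto
  also have "(\<Prod>i\<in>{1..Suc m} - {j}. (x j - x i) * (x k - x i)) = 0"
    using jk False by (intro prod_zero bexI[of _ k]) auto
  finally have "(\<Prod>i=1..m. (x j - t i) * (x k - t i)) * (level m \<zeta> t (x j) - level m \<zeta> t (x k)) = 0"
    using bezoutian_level[OF nt nt, OF jk, of \<zeta>] by simp
  moreover have "(\<Prod>i=1..m. (x j - t i) * (x k - t i)) \<noteq> 0"
    using nt jk by (auto simp: image_iff)
  ultimately show ?thesis by simp
qed simp

text \<open>Equal levels make the other \<open>m\<close> points roots of the Bezoutian of
  \<open>t\<close> with one argument frozen at \<open>x k\<close>. As this polynomial has degree at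
  most \<open>m\<close>, they are all its roots, and its logarithmic derivative gives the equation
  for \<open>x k\<close>.\<close>

lemma level_stieltjes_system:
  assumes \<zeta>: "\<forall>j\<in>{1..m}. Im (\<zeta> j) > 0" and m: "m > 0"
    and t: "stieltjes_system m m \<zeta> t" and inj: "inj_on x {1..Suc m}"
    and nt: "\<And>k. k \<in> {1..Suc m} \<Longrightarrow> x k \<notin> t ` {1..m}"
    and level: "\<And>k. k \<in> {1..Suc m} \<Longrightarrow> level m \<zeta> t (x k) = l"
  shows "stieltjes_system (Suc m) m \<zeta> x"
  unfolding stieltjes_system_poly_iff[OF \<zeta>]
proof (intro conjI inj ballI)
  fix k assume k: "k \<in> {1..Suc m}"
  show "poly (pderiv (zero_poly m \<zeta>)) (x k) =
      poly (zero_poly m \<zeta>) (x k) * (\<Sum>j\<in>{1..Suc m} - {k}. 2 / (x k - x j))"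
  proof (rule bezout_nodes_log_derivative)
    show "poly (zero_poly m \<zeta>) z = pform {1..m} 1 (residue_weight m m \<zeta> t) (\<lambda>i. (z - t i)\<^sup>2)" for z
      by (rule zero_poly_representation[OF \<zeta> t _ m]) simp
    show "poly (zero_poly m \<zeta>) (x k) \<noteq> 0" using poly_zero_poly_pos[OF \<zeta>, of "x k"] by simp
    show "inj_on x ({1..Suc m} - {k})" using inj by (rule inj_on_subset) auto
    fix j assume j: "j \<in> {1..Suc m} - {k}"
    then have "x j \<noteq> x k" using inj k by (auto simp: inj_on_def)
    then show "pform {1..m} 1 (residue_weight m m \<zeta> t) (\<lambda>i. (x j - t i) * (x k - t i)) = 0"
      using bezoutian_level[OF nt nt, of j k \<zeta>] j k level by simp
  qed (use k in auto)
qed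

section \<open>The energy\<close>

text \<open>Summing over all ordered pairs absorbs the factor 2, and the diagonal adds nothing
  because \<open>ln 0 = 0\<close>. In this form the energy visibly depends only on the set of
  points.\<close>

lemma energy_symmetric:
  "energy m \<zeta> t = (\<Sum>k=1..m. \<Sum>j=1..m. ln ((cmod (of_real (t k) - \<zeta> j))\<^sup>2)) -
    (\<Sum>k=1..m. \<Sum>j=1..m. ln \<bar>t j - t k\<bar>)"
proof -
  have norm: "cmod ((of_real u - z) * (of_real u - cnj z)) = (cmod (of_real u - z))\<^sup>2" for u z
  proof -
    have "of_real u - cnj z = cnj (of_real u - z)" by simp
    then show ?thesis by (metis complex_mod_cnj norm_mult power2_eq_square)
  qed
  define f where "f j k = ln \<bar>t j - t k\<bar>" for j k
  have f_sym: "f j k = f k j" and f_diag: "f k k = 0" for j k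
    by (simp_all add: f_def abs_minus_commute)
  have up: "(\<Sum>j\<in>{k<..m}. f j k) = (\<Sum>j\<in>{j. j \<in> {1..m} \<and> k < j}. f j k)" if "k \<in> {1..m}" for k
    using that by (intro sum.cong) auto
  have swap: "(\<Sum>k=1..m. \<Sum>j\<in>{k<..m}. f j k) = (\<Sum>k=1..m. \<Sum>j\<in>{j. j \<in> {1..m} \<and> j < k}. f j k)"
  proof -
    have "(\<Sum>k=1..m. \<Sum>j\<in>{k<..m}. f j k) = (\<Sum>k=1..m. \<Sum>j\<in>{j. j \<in> {1..m} \<and> k < j}. f j k)"
      by (rule sum.cong[OF refl up])
    also have "\<dots> = (\<Sum>j=1..m. \<Sum>k\<in>{k. k \<in> {1..m} \<and> k < j}. f j k)"
      by (rule sum.swap_restrict) auto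
    finally show ?thesis by (subst (2) f_sym)
  qed
  have "(\<Sum>j=1..m. f j k) = (\<Sum>j\<in>{k<..m}. f j k) + (\<Sum>j\<in>{j. j \<in> {1..m} \<and> j < k}. f j k)"
    if k: "k \<in> {1..m}" for k
  proof -
    have "{1..m} = insert k ({k<..m} \<union> {j. j \<in> {1..m} \<and> j < k})" using k by auto
    then have "(\<Sum>j=1..m. f j k) = (\<Sum>j\<in>insert k ({k<..m} \<union> {j. j \<in> {1..m} \<and> j < k}). f j k)"
      by (rule sum.cong) (rule refl)
    also have "\<dots> = (\<Sum>j\<in>{k<..m}. f j k) + (\<Sum>j\<in>{j. j \<in> {1..m} \<and> j < k}. f j k)"
      by (subst sum.insert, simp, simp, subst sum.union_disjoint) (auto simp: f_diag)
    finally show ?thesis .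
  qed
  then have "(\<Sum>k=1..m. \<Sum>j=1..m. f j k) =
      (\<Sum>k=1..m. (\<Sum>j\<in>{k<..m}. f j k) + (\<Sum>j\<in>{j. j \<in> {1..m} \<and> j < k}. f j k))"
    by (rule sum.cong[OF refl])
  also have "\<dots> = 2 * (\<Sum>k=1..m. \<Sum>j\<in>{k<..m}. f j k)"
    unfolding sum.distrib swap[symmetric] by simp
  finally show ?thesis unfolding energy_def norm f_def by simp
qed

lemma energy_image_eq:
  assumes "inj_on s {1..m}" "inj_on t {1..m}" "s ` {1..m} = t ` {1..m}"
  shows "energy m \<zeta> s = energy m \<zeta> t"
proof -
  have "energy m \<zeta> r = (\<Sum>u\<in>r ` {1..m}. \<Sum>j=1..m. ln ((cmod (of_real u - \<zeta> j))\<^sup>2)) -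
      (\<Sum>u\<in>r ` {1..m}. \<Sum>v\<in>r ` {1..m}. ln \<bar>v - u\<bar>)" if "inj_on r {1..m}" for r
    unfolding energy_symmetric sum.reindex[OF that] by simp
  then show ?thesis using assms by simp
qed

lemma stieltjes_system_image_eq:
  assumes inj: "inj_on s {1..N}" and img: "s ` {1..N} = t ` {1..N}" and t: "stieltjes_system N m \<zeta> t"
  shows "stieltjes_system N m \<zeta> s"
proof -
  have eq: "(\<Sum>j\<in>{1..N} - {k}. 2 / (r k - r j)) = (\<Sum>v\<in>r ` {1..N} - {r k}. 2 / (r k - v))"
    if "inj_on r {1..N}" "k \<in> {1..N}" for r :: "nat \<Rightarrow> real" and k
  proof -
    have "r ` {1..N} - {r k} = r ` ({1..N} - {k})"
      using inj_on_image_set_diff[OF that(1), of "{1..N}" "{k}"] that(2) by simp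
    then show ?thesis
      using inj_on_subset[OF that(1), of "{1..N} - {k}"] by (simp add: sum.reindex)
  qed
  have injt: "inj_on t {1..N}" using t by (simp add: stieltjes_system_def)
  show ?thesis
    unfolding stieltjes_system_real_iff
  proof (intro conjI inj ballI)
    fix k assume k: "k \<in> {1..N}"
    then obtain l where l: "l \<in> {1..N}" "s k = t l" using img by blast
    have "(\<Sum>j\<in>{1..N} - {k}. 2 / (s k - s j)) = (\<Sum>v\<in>t ` {1..N} - {t l}. 2 / (t l - v))"
      using eq[OF inj k] by (simp only: img l(2))
    also have "\<dots> = (\<Sum>j\<in>{1..N} - {l}. 2 / (t l - t j))" by (rule eq[OF injt l(1), symmetric])
    also have "\<dots> = (\<Sum>j=1..m. 2 * (t l - Re (\<zeta> j)) / (cmod (of_real (t l) - \<zeta> j))\<^sup>2)"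
      using t l(1) unfolding stieltjes_system_real_iff by blast
    finally show "(\<Sum>j\<in>{1..N} - {k}. 2 / (s k - s j)) =
      (\<Sum>j=1..m. 2 * (s k - Re (\<zeta> j)) / (cmod (of_real (s k) - \<zeta> j))\<^sup>2)" by (simp only: l(2))
  qed
qed

lemma energy_has_derivative:
  assumes \<zeta>: "\<forall>j\<in>{1..m}. Im (\<zeta> j) > 0" and inj: "inj_on t {1..m}" and k: "k \<in> {1..m}"
  shows "((\<lambda>u. energy m \<zeta> (t(k := u))) has_real_derivative
    (\<Sum>j=1..m. 2 * (t k - Re (\<zeta> j)) / (cmod (of_real (t k) - \<zeta> j))\<^sup>2) -
    (\<Sum>j\<in>{1..m} - {k}. 2 / (t k - t j))) (at (t k))"
proof -
  let ?I = "{1..m} - {k}"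
  define C where "C = (\<Sum>i\<in>?I. \<Sum>j=1..m. ln ((cmod (of_real (t i) - \<zeta> j))\<^sup>2)) -
    (\<Sum>i\<in>?I. \<Sum>j\<in>?I. ln \<bar>t j - t i\<bar>)"
  have split: "sum g {1..m} = g k + sum g ?I" for g :: "nat \<Rightarrow> real"
    using k by (subst sum.remove[of _ k]) auto
  \<comment> \<open>The variable \<open>u\<close> occurs once as row and once as column of the
    symmetric double sum, hence the factor 2.\<close>
  have E: "energy m \<zeta> (t(k := u)) = C + (\<Sum>j=1..m. ln ((cmod (of_real u - \<zeta> j))\<^sup>2)) -
      2 * (\<Sum>j\<in>?I. ln \<bar>u - t j\<bar>)" for u
  proof -
    let ?s = "t(k := u)"
    have "(\<Sum>i=1..m. \<Sum>j=1..m. ln ((cmod (of_real (?s i) - \<zeta> j))\<^sup>2)) =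
        (\<Sum>j=1..m. ln ((cmod (of_real u - \<zeta> j))\<^sup>2)) +
        (\<Sum>i\<in>?I. \<Sum>j=1..m. ln ((cmod (of_real (t i) - \<zeta> j))\<^sup>2))"
      by (subst split) simp
    moreover have "(\<Sum>i=1..m. \<Sum>j=1..m. ln \<bar>?s j - ?s i\<bar>) =
        2 * (\<Sum>j\<in>?I. ln \<bar>u - t j\<bar>) + (\<Sum>i\<in>?I. \<Sum>j\<in>?I. ln \<bar>t j - t i\<bar>)"
    proof -
      have "(\<Sum>j=1..m. ln \<bar>?s j - ?s i\<bar>) = ln \<bar>u - t i\<bar> + (\<Sum>j\<in>?I. ln \<bar>t j - t i\<bar>)" if "i \<in> ?I" for i
        using that by (subst split) simp
      moreover have "(\<Sum>j=1..m. ln \<bar>?s j - ?s k\<bar>) = (\<Sum>j\<in>?I. ln \<bar>u - t j\<bar>)"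
        by (subst split) (simp add: abs_minus_commute)
      ultimately show ?thesis by (subst split) (simp add: sum.distrib)
    qed
    ultimately show ?thesis unfolding energy_symmetric C_def by simp
  qed
  have dln: "((\<lambda>u. ln ((cmod (of_real u - \<zeta> j))\<^sup>2)) has_real_derivative
      2 * (t k - Re (\<zeta> j)) / (cmod (of_real (t k) - \<zeta> j))\<^sup>2) (at (t k))" if "j \<in> {1..m}" for j
  proof -
    have "Im (\<zeta> j) \<noteq> 0" using \<zeta> that by force
    then have pos: "(t k - Re (\<zeta> j))\<^sup>2 + (Im (\<zeta> j))\<^sup>2 > 0" by (simp add: sum_power2_gt_zero_iff)
    have "((\<lambda>u. ln ((u - Re (\<zeta> j))\<^sup>2 + (Im (\<zeta> j))\<^sup>2)) has_real_derivative
        2 * (t k - Re (\<zeta> j)) / ((t k - Re (\<zeta> j))\<^sup>2 + (Im (\<zeta> j))\<^sup>2)) (at (t k))"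
      using pos by (auto intro!: derivative_eq_intros)
    then show ?thesis by (simp add: cmod_power2)
  qed
  have dabs: "((\<lambda>u. ln \<bar>u - t j\<bar>) has_real_derivative 1 / (t k - t j)) (at (t k))" if "j \<in> ?I" for j
  proof -
    have ne: "t k \<noteq> t j" using that k inj_onD[OF inj, of k j] by auto
    \<comment> \<open>The logarithm of the absolute value is differentiated as half the logarithm of
      the square, which avoids a case split on the sign.\<close>
    have "(t k - t j)\<^sup>2 > 0" using ne by simp
    then have "((\<lambda>u. ln ((u - t j)\<^sup>2)) has_real_derivative 2 * (t k - t j) / (t k - t j)\<^sup>2) (at (t k))"
      by (auto intro!: derivative_eq_intros)
    then have "((\<lambda>u. ln ((u - t j)\<^sup>2) / 2) has_real_derivative 2 * (t k - t j) / (t k - t j)\<^sup>2 / 2) (at (t k))"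
      by (rule DERIV_cdivide)
    also have "2 * (t k - t j) / (t k - t j)\<^sup>2 / 2 = 1 / (t k - t j)"
    proof -
      have cancel: "2 * x / x\<^sup>2 / 2 = 1 / x" if "x \<noteq> 0" for x :: real
        using that by (simp add: power2_eq_square)
      show ?thesis by (rule cancel) (use ne in simp)
    qed
    finally have "((\<lambda>u. ln ((u - t j)\<^sup>2) / 2) has_real_derivative 1 / (t k - t j)) (at (t k))" .
    moreover have "ln ((u - t j)\<^sup>2) / 2 = ln \<bar>u - t j\<bar>" for u
      using ln_realpow[of "\<bar>u - t j\<bar>" 2] by (cases "u = t j") simp_all
    ultimately show ?thesis by simp
  qed
  have "((\<lambda>u. C + (\<Sum>j=1..m. ln ((cmod (of_real u - \<zeta> j))\<^sup>2)) - 2 * (\<Sum>j\<in>?I. ln \<bar>u - t j\<bar>))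
      has_real_derivative 0 + (\<Sum>j=1..m. 2 * (t k - Re (\<zeta> j)) / (cmod (of_real (t k) - \<zeta> j))\<^sup>2) -
      2 * (\<Sum>j\<in>?I. 1 / (t k - t j))) (at (t k))"
    by (intro DERIV_diff DERIV_add DERIV_const DERIV_sum DERIV_cmult dln dabs)
  then show ?thesis unfolding E by (simp add: sum_distrib_left)
qed

lemma energy_critical_point_iff:
  assumes \<zeta>: "\<forall>j\<in>{1..m}. Im (\<zeta> j) > 0"
  shows "energy_critical_point m \<zeta> t \<longleftrightarrow> stieltjes_system m m \<zeta> t"
proof (cases "inj_on t {1..m}")
  case True
  have zero_iff: "(f has_real_derivative 0) (at x) \<longleftrightarrow> A = B"
    if "(f has_real_derivative B - A) (at x)" for f :: "real \<Rightarrow> real" and x A B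
    using that DERIV_unique[OF that, of 0] by auto
  have "((\<lambda>u. energy m \<zeta> (t(k := u))) has_real_derivative 0) (at (t k)) \<longleftrightarrow>
      (\<Sum>j\<in>{1..m} - {k}. 2 / (t k - t j)) =
      (\<Sum>j=1..m. 2 * (t k - Re (\<zeta> j)) / (cmod (of_real (t k) - \<zeta> j))\<^sup>2)" if "k \<in> {1..m}" for k
    by (rule zero_iff[OF energy_has_derivative[OF \<zeta> True that]])
  then show ?thesis
    unfolding energy_critical_point_def stieltjes_system_real_iff by (intro conj_cong ball_cong refl)
next
  case False
  then show ?thesis by (auto simp: energy_critical_point_def stieltjes_system_def)
qed

section \<open>Existence of a minimizer of the energy\<close>

text \<open>This is exp (- W) written as a product. It is continuous on the whole space and 0
  exactly at collisions, where \<open>energy\<close> has no meaningful value, so a maximum can be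
  sought without excluding collisions beforehand.\<close>

definition boltzmann :: "nat \<Rightarrow> (nat \<Rightarrow> complex) \<Rightarrow> (nat \<Rightarrow> real) \<Rightarrow> real" where
  "boltzmann m \<zeta> t = (\<Prod>k=1..m. \<Prod>j\<in>{1..m} - {k}. \<bar>t j - t k\<bar>) /
    (\<Prod>k=1..m. \<Prod>j=1..m. (cmod (of_real (t k) - \<zeta> j))\<^sup>2)"

lemma boltzmann_denominator_pos:
  fixes m :: nat
  assumes "\<forall>j\<in>{1..m}. Im (\<zeta> j) > 0"
  shows "(\<Prod>k=1..m. \<Prod>j=1..m. (cmod (of_real (t k) - \<zeta> j))\<^sup>2) > 0"
  using poly_zero_poly_pos[OF assms] unfolding poly_zero_poly by (rule prod_pos)

lemma boltzmann_pos_iff: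
  assumes "\<forall>j\<in>{1..m}. Im (\<zeta> j) > 0"
  shows "boltzmann m \<zeta> t > 0 \<longleftrightarrow> inj_on t {1..m}"
proof -
  let ?P = "\<Prod>k=1..m. \<Prod>j\<in>{1..m} - {k}. \<bar>t j - t k\<bar>"
  have "boltzmann m \<zeta> t > 0 \<longleftrightarrow> ?P > 0"
    unfolding boltzmann_def using boltzmann_denominator_pos[OF assms, of t]
    by (simp only: zero_less_divide_iff) auto
  also have "\<dots> \<longleftrightarrow> ?P \<noteq> 0" using prod_nonneg[of "{1..m}" "\<lambda>k. \<Prod>j\<in>{1..m} - {k}. \<bar>t j - t k\<bar>"]
    by (simp add: prod_nonneg less_le)
  also have "\<dots> \<longleftrightarrow> (\<forall>k\<in>{1..m}. \<forall>j\<in>{1..m} - {k}. t j \<noteq> t k)"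
    by (simp only: prod_zero_iff finite_atLeastAtMost finite_Diff) simp
  also have "\<dots> \<longleftrightarrow> inj_on t {1..m}" unfolding inj_on_def by blast
  finally show ?thesis .
qed

lemma energy_boltzmann:
  assumes \<zeta>: "\<forall>j\<in>{1..m}. Im (\<zeta> j) > 0" and inj: "inj_on t {1..m}"
  shows "energy m \<zeta> t = - ln (boltzmann m \<zeta> t)"
proof -
  let ?P = "\<Prod>k=1..m. \<Prod>j\<in>{1..m} - {k}. \<bar>t j - t k\<bar>"
  let ?Q = "\<Prod>k=1..m. \<Prod>j=1..m. (cmod (of_real (t k) - \<zeta> j))\<^sup>2"
  have ne: "t j \<noteq> t k" if "k \<in> {1..m}" "j \<in> {1..m} - {k}" for j k
    using that inj_onD[OF inj, of j k] by auto
  have nz: "(cmod (of_real (t k) - \<zeta> j))\<^sup>2 \<noteq> 0" if "j \<in> {1..m}" for j k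
    using \<zeta> that by (metis Im_complex_of_real eq_iff_diff_eq_0 less_irrefl norm_eq_zero power_eq_0_iff)
  have Pk: "(\<Prod>j\<in>{1..m} - {k}. \<bar>t j - t k\<bar>) > 0" if "k \<in> {1..m}" for k
    using ne[OF that] by (intro prod_pos) auto
  have Qk: "(\<Prod>j=1..m. (cmod (of_real (t k) - \<zeta> j))\<^sup>2) > 0" for k
    using poly_zero_poly_pos[OF \<zeta>] unfolding poly_zero_poly .
  have "ln ?Q = (\<Sum>k=1..m. ln (\<Prod>j=1..m. (cmod (of_real (t k) - \<zeta> j))\<^sup>2))"
    by (rule ln_prod) (simp, metis Qk less_irrefl)
  also have "\<dots> = (\<Sum>k=1..m. \<Sum>j=1..m. ln ((cmod (of_real (t k) - \<zeta> j))\<^sup>2))"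
    by (intro sum.cong refl ln_prod nz) auto
  finally have "ln ?Q = (\<Sum>k=1..m. \<Sum>j=1..m. ln ((cmod (of_real (t k) - \<zeta> j))\<^sup>2))" .
  moreover have "ln ?P = (\<Sum>k=1..m. \<Sum>j\<in>{1..m} - {k}. ln \<bar>t j - t k\<bar>)"
  proof -
    have "ln ?P = (\<Sum>k=1..m. ln (\<Prod>j\<in>{1..m} - {k}. \<bar>t j - t k\<bar>))"
      by (rule ln_prod) (simp, metis Pk less_irrefl)
    also have "\<dots> = (\<Sum>k=1..m. \<Sum>j\<in>{1..m} - {k}. ln \<bar>t j - t k\<bar>)"
      by (intro sum.cong refl ln_prod) (use ne in force)+
    finally show ?thesis .
  qed
  moreover have "(\<Sum>j\<in>{1..m} - {k}. ln \<bar>t j - t k\<bar>) = (\<Sum>j=1..m. ln \<bar>t j - t k\<bar>)" if "k \<in> {1..m}" for k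
    using that by (subst (2) sum.remove[of _ k]) auto
  moreover have "ln (?P / ?Q) = ln ?P - ln ?Q"
  proof (rule ln_divide_pos)
    show "?P > 0" using Pk by (rule prod_pos)
    show "?Q > 0" by (rule boltzmann_denominator_pos[OF \<zeta>])
  qed
  ultimately show ?thesis unfolding energy_symmetric boltzmann_def by simp
qed

lemma real_le_norm_diff:
  assumes "\<forall>j\<in>{1..m::nat}. Im (\<zeta> j) > 0"
  shows "\<exists>B>0. \<forall>j\<in>{1..m}. \<forall>u. 1 + \<bar>u\<bar> \<le> B * cmod (of_real u - \<zeta> j)"
proof -
  \<comment> \<open>From 1 + |u| \<le> (1 + |\<zeta> j|) + |u - \<zeta> j|, where the bracket is
    absorbed by |u - \<zeta> j| \<ge> Im (\<zeta> j).\<close>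
  define b where "b j = 1 + (1 + cmod (\<zeta> j)) / Im (\<zeta> j)" for j
  have b: "b j \<ge> 0" "1 + \<bar>u\<bar> \<le> b j * cmod (of_real u - \<zeta> j)" if j: "j \<in> {1..m}" for j u
  proof -
    have Im: "Im (\<zeta> j) > 0" using assms j by blast
    then show "b j \<ge> 0" by (simp add: b_def)
    have "Im (\<zeta> j) \<le> cmod (of_real u - \<zeta> j)"
      using abs_Im_le_cmod[of "of_real u - \<zeta> j"] by simp
    then have "(1 + cmod (\<zeta> j)) * 1 \<le> (1 + cmod (\<zeta> j)) * (cmod (of_real u - \<zeta> j) / Im (\<zeta> j))"
      using Im by (intro mult_left_mono) auto
    moreover have "\<bar>u\<bar> \<le> cmod (\<zeta> j) + cmod (of_real u - \<zeta> j)"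
      using norm_triangle_ineq[of "\<zeta> j" "of_real u - \<zeta> j"] by simp
    ultimately show "1 + \<bar>u\<bar> \<le> b j * cmod (of_real u - \<zeta> j)"
      by (simp add: b_def distrib_right)
  qed
  define B where "B = 1 + (\<Sum>j=1..m. b j)"
  have "1 + \<bar>u\<bar> \<le> B * cmod (of_real u - \<zeta> j)" if j: "j \<in> {1..m}" for j u
  proof -
    have "b j \<le> (\<Sum>j=1..m. b j)" using b(1) j by (intro member_le_sum) auto
    then have "b j \<le> B" by (simp add: B_def)
    then have "b j * cmod (of_real u - \<zeta> j) \<le> B * cmod (of_real u - \<zeta> j)"
      by (intro mult_right_mono) auto
    then show ?thesis using b(2)[OF j, of u] by linarith
  qed
  moreover have "B > 0" using b(1) unfolding B_def by (intro add_pos_nonneg sum_nonneg) auto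
  ultimately show ?thesis by blast
qed

text \<open>A count of powers of h k = 1 + |t k|. Since |t j - t k| \<le> h j * h k, the numerator
  carries at most the power 2(m - 1) of each h k, while the denominator carries 2m up to a factor
  \<open>B^2\<close> for each of the m * m pairs. The spare squares dominate any single h i.\<close>

lemma boltzmann_decay:
  assumes \<zeta>: "\<forall>j\<in>{1..m}. Im (\<zeta> j) > 0"
  shows "\<exists>C. \<forall>t. \<forall>i\<in>{1..m}. boltzmann m \<zeta> t * (1 + \<bar>t i\<bar>) \<le> C"
proof -
  obtain B where B: "B > 0" "\<And>j u. j \<in> {1..m} \<Longrightarrow> 1 + \<bar>u\<bar> \<le> B * cmod (of_real u - \<zeta> j)"
    using real_le_norm_diff[OF \<zeta>] by blast
  have "boltzmann m \<zeta> t * (1 + \<bar>t i\<bar>) \<le> ((B\<^sup>2) ^ m) ^ m" if i: "i \<in> {1..m}" for t i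
  proof -
    let ?P = "\<Prod>k=1..m. \<Prod>j\<in>{1..m} - {k}. \<bar>t j - t k\<bar>"
    let ?Q = "\<Prod>k=1..m. \<Prod>j=1..m. (cmod (of_real (t k) - \<zeta> j))\<^sup>2"
    define h where "h k = 1 + \<bar>t k\<bar>" for k
    have h: "h k \<ge> 1" for k by (simp add: h_def)
    have h0: "h k \<ge> 0" for k using h[of k] by linarith
    have Q: "?Q > 0" by (rule boltzmann_denominator_pos[OF \<zeta>])
    have P0: "?P \<ge> 0" by (intro prod_nonneg) auto
    have hi: "h i \<le> (\<Prod>k=1..m. (h k)\<^sup>2)"
    proof -
      have "h i * 1 \<le> h i * h i" using h[of i] by (intro mult_left_mono) auto
      moreover have "(h i)\<^sup>2 * 1 \<le> (h i)\<^sup>2 * (\<Prod>k\<in>{1..m} - {i}. (h k)\<^sup>2)"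
        using h by (intro mult_left_mono prod_ge_1) (auto simp: one_le_power)
      moreover have "(\<Prod>k=1..m. (h k)\<^sup>2) = (h i)\<^sup>2 * (\<Prod>k\<in>{1..m} - {i}. (h k)\<^sup>2)"
        using i by (intro prod.remove) auto
      ultimately show ?thesis by (simp add: power2_eq_square)
    qed
    have "?P \<le> (\<Prod>k=1..m. \<Prod>j\<in>{1..m} - {k}. h j * h k)"
    proof (intro prod_mono conjI prod_nonneg abs_ge_zero)
      fix k j
      have "0 \<le> \<bar>t j\<bar> * \<bar>t k\<bar>" by simp
      then show "\<bar>t j - t k\<bar> \<le> h j * h k"
        using abs_triangle_ineq4[of "t j" "t k"]
        unfolding h_def distrib_left distrib_right mult_1_left mult_1_right by linarith
    qed
    also have "\<dots> = (\<Prod>k=1..m. \<Prod>j\<in>{1..m} - {k}. h j) * (\<Prod>k=1..m. \<Prod>j\<in>{1..m} - {k}. h k)"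
      by (simp add: prod.distrib)
    also have "(\<Prod>k=1..m. \<Prod>j\<in>{1..m} - {k}. h j) = (\<Prod>k=1..m. \<Prod>j\<in>{1..m} - {k}. h k)"
    proof -
      have set: "{1..m} - {k} = {j. j \<in> {1..m} \<and> k \<noteq> j}" "{1..m} - {k} = {j. j \<in> {1..m} \<and> j \<noteq> k}" for k by auto
      have "(\<Prod>k=1..m. \<Prod>j\<in>{j. j \<in> {1..m} \<and> k \<noteq> j}. h j) = (\<Prod>j=1..m. \<Prod>k\<in>{k. k \<in> {1..m} \<and> k \<noteq> j}. h j)"
        by (rule prod.swap_restrict) auto
      then show ?thesis unfolding set(1)[symmetric] set(2)[symmetric] .
    qed
    also have "\<dots> = (\<Prod>k=1..m. h k ^ (m - 1))"
      by (intro prod.cong refl) (simp add: card_Diff_singleton)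
    finally have "?P * (\<Prod>k=1..m. (h k)\<^sup>2) \<le>
        ((\<Prod>k=1..m. h k ^ (m - 1)) * (\<Prod>k=1..m. h k ^ (m - 1))) * (\<Prod>k=1..m. (h k)\<^sup>2)"
      by (intro mult_right_mono prod_nonneg) auto
    also have "\<dots> = (\<Prod>k=1..m. h k ^ (m - 1) * h k ^ (m - 1) * (h k)\<^sup>2)"
      by (simp add: prod.distrib)
    also have "\<dots> = (\<Prod>k=1..m. \<Prod>j=1..m. (h k)\<^sup>2)"
    proof (intro prod.cong refl)
      fix k
      obtain l where l: "m = Suc l" using i by (cases m) auto
      show "h k ^ (m - 1) * h k ^ (m - 1) * (h k)\<^sup>2 = (\<Prod>j=1..m. (h k)\<^sup>2)"
        by (simp add: l power_mult_distrib power2_eq_square mult_ac)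
    qed
    also have "\<dots> \<le> (\<Prod>k=1..m. \<Prod>j=1..m. B\<^sup>2 * (cmod (of_real (t k) - \<zeta> j))\<^sup>2)"
    proof (intro prod_mono conjI prod_nonneg)
      fix k j assume "j \<in> {1..m}"
      then have "(h k)\<^sup>2 \<le> (B * cmod (of_real (t k) - \<zeta> j))\<^sup>2"
        using B(2) h0[of k] by (intro power_mono) (auto simp: h_def)
      then show "(h k)\<^sup>2 \<le> B\<^sup>2 * (cmod (of_real (t k) - \<zeta> j))\<^sup>2" by (simp add: power_mult_distrib)
    qed auto
    also have "\<dots> = ((B\<^sup>2) ^ m) ^ m * ?Q"
      by (simp add: prod.distrib)
    finally have "?P * (\<Prod>k=1..m. (h k)\<^sup>2) \<le> ((B\<^sup>2) ^ m) ^ m * ?Q" .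
    moreover have "?P * h i \<le> ?P * (\<Prod>k=1..m. (h k)\<^sup>2)" using hi P0 by (rule mult_left_mono)
    ultimately have "?P * h i \<le> ((B\<^sup>2) ^ m) ^ m * ?Q" by linarith
    then have "?P * h i / ?Q \<le> ((B\<^sup>2) ^ m) ^ m" using Q by (subst pos_divide_le_eq)
    then show ?thesis unfolding boltzmann_def h_def by simp
  qed
  then show ?thesis by blast
qed

lemma compact_PiE_real:
  fixes S :: "'b \<Rightarrow> real set"
  assumes "\<And>i. compact (S i)"
  shows "compact (PiE UNIV S)"
proof -
  have "compactin (product_topology (\<lambda>_. euclidean) UNIV) (PiE UNIV S)"
    unfolding compactin_PiE using assms by simp
  then show ?thesis by (simp add: euclidean_product_topology)
qed

lemma boltzmann_maximum:
  assumes \<zeta>: "\<forall>j\<in>{1..m}. Im (\<zeta> j) > 0"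
  shows "\<exists>r. inj_on r {1..m} \<and> (\<forall>s. boltzmann m \<zeta> s \<le> boltzmann m \<zeta> r)"
proof -
  obtain C where C: "\<And>t i. i \<in> {1..m} \<Longrightarrow> boltzmann m \<zeta> t * (1 + \<bar>t i\<bar>) \<le> C"
    using boltzmann_decay[OF \<zeta>] by blast
  \<comment> \<open>Any configuration of distinct points serves as reference. A competitor with at
    least its value \<open>g0\<close> has all coordinates bounded by \<open>C / g0\<close>, so the
    maximum over the box is global.\<close>
  define t0 where "t0 k = (if k \<in> {1..m} then real k else 0)" for k
  define g0 where "g0 = boltzmann m \<zeta> t0"
  have g0: "g0 > 0" unfolding g0_def boltzmann_pos_iff[OF \<zeta>] by (auto simp: inj_on_def t0_def)
  define M where "M = C / g0"
  \<comment> \<open>Compactness is taken in the product topology on functions on all of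
    \<open>nat\<close>, so the coordinates outside \<open>{1..m}\<close> are pinned to 0.\<close>
  define box where "box = PiE UNIV (\<lambda>k. if k \<in> {1..m} then {-M..M} else {0})"
  have inbox: "\<bar>s i\<bar> \<le> M" if "boltzmann m \<zeta> s \<ge> g0" "i \<in> {1..m}" for s i
  proof -
    have "g0 * (1 + \<bar>s i\<bar>) \<le> boltzmann m \<zeta> s * (1 + \<bar>s i\<bar>)" using that(1) by (intro mult_right_mono) auto
    also have "\<dots> \<le> C" by (rule C[OF that(2)])
    finally have "1 + \<bar>s i\<bar> \<le> M" using g0 by (simp add: M_def field_simps)
    then show ?thesis by simp
  qed
  have "compact box" unfolding box_def by (intro compact_PiE_real) auto
  moreover have t0: "t0 \<in> box"
  proof -
    have "\<bar>t0 i\<bar> \<le> M" if "i \<in> {1..m}" for i using inbox[OF _ that, of t0] by (simp add: g0_def)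
    then show ?thesis unfolding box_def by (force simp: t0_def)
  qed
  moreover have "continuous_on box (boltzmann m \<zeta>)"
  proof -
    have co: "continuous_on box (\<lambda>t. t i)" for i :: nat
      by (rule continuous_on_subset[OF continuous_on_product_coordinates]) simp
    show ?thesis
      unfolding boltzmann_def
      by (intro continuous_intros co ballI less_imp_neq[THEN not_sym] boltzmann_denominator_pos[OF \<zeta>])
  qed
  ultimately obtain r where r: "r \<in> box" "\<And>s. s \<in> box \<Longrightarrow> boltzmann m \<zeta> s \<le> boltzmann m \<zeta> r"
    using continuous_attains_sup[of box "boltzmann m \<zeta>"] by blast
  have r0: "g0 \<le> boltzmann m \<zeta> r" unfolding g0_def by (rule r(2)[OF t0])
  have "boltzmann m \<zeta> s \<le> boltzmann m \<zeta> r" for s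
  proof (cases "boltzmann m \<zeta> s \<ge> g0")
    case True
    define s' where "s' k = (if k \<in> {1..m} then s k else 0)" for k
    have "boltzmann m \<zeta> s' = boltzmann m \<zeta> s"
      unfolding boltzmann_def s'_def
      by (intro arg_cong2[where f = "(/)"] prod.cong refl) auto
    moreover have "s' \<in> box" unfolding box_def using inbox[OF True] by (force simp: s'_def abs_le_iff)
    ultimately show ?thesis using r(2) by metis
  next
    case False
    then show ?thesis using r0 by linarith
  qed
  moreover have "inj_on r {1..m}" using g0 r0 boltzmann_pos_iff[OF \<zeta>, of r] by linarith
  ultimately show ?thesis by blast
qed

lemma energy_minimum:
  assumes \<zeta>: "\<forall>j\<in>{1..m}. Im (\<zeta> j) > 0"
  shows "\<exists>r. stieltjes_system m m \<zeta> r \<and>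
    (\<forall>s. inj_on s {1..m} \<longrightarrow> energy m \<zeta> r \<le> energy m \<zeta> s)"
proof -
  obtain r where r: "inj_on r {1..m}" "\<And>s. boltzmann m \<zeta> s \<le> boltzmann m \<zeta> r"
    using boltzmann_maximum[OF \<zeta>] by blast
  have min: "energy m \<zeta> r \<le> energy m \<zeta> s" if "inj_on s {1..m}" for s
    using r that boltzmann_pos_iff[OF \<zeta>] by (simp add: energy_boltzmann[OF \<zeta>])
  have "energy_critical_point m \<zeta> r"
    unfolding energy_critical_point_def
  proof (intro conjI r ballI)
    fix k assume k: "k \<in> {1..m}"
    obtain D where D: "((\<lambda>u. energy m \<zeta> (r(k := u))) has_real_derivative D) (at (r k))"
      using energy_has_derivative[OF \<zeta> r(1) k] by blast
    \<comment> \<open>\<open>min\<close> compares with configurations of distinct points only, so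
      \<open>r k\<close> may be moved only within a ball that avoids the other points.\<close>
    have "open (- r ` ({1..m} - {k}))" by (intro open_Compl finite_imp_closed) auto
    moreover have "r k \<in> - r ` ({1..m} - {k})"
      using inj_onD[OF r(1), of k] k by auto
    ultimately obtain e where e: "e > 0" "ball (r k) e \<subseteq> - r ` ({1..m} - {k})"
      by (rule openE)
    have "energy m \<zeta> (r(k := r k)) \<le> energy m \<zeta> (r(k := u))" if "\<bar>r k - u\<bar> < e" for u
    proof -
      let ?I = "{1..m} - {k}"
      have "u \<notin> r ` ?I" using e(2) that by (auto simp: dist_real_def)
      moreover have "inj_on r ?I" by (rule inj_on_subset[OF r(1)]) auto
      moreover have "inj_on (r(k := u)) ?I \<longleftrightarrow> inj_on r ?I" by (rule inj_on_cong) auto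
      moreover have "(r(k := u)) ` ?I = r ` ?I" by (rule image_cong) auto
      ultimately have "inj_on (r(k := u)) (insert k ?I)" by (simp only: inj_on_insert) simp
      then have "inj_on (r(k := u)) {1..m}" using insert_Diff[OF k] by (simp only:)
      then show ?thesis using min by simp
    qed
    then have "D = 0" by (intro DERIV_local_min[OF D e(1)]) blast
    then show "((\<lambda>u. energy m \<zeta> (r(k := u))) has_real_derivative 0) (at (r k))" using D by simp
  qed
  then show ?thesis using min unfolding energy_critical_point_iff[OF \<zeta>] by blast
qed

section \<open>Level sets in the gaps\<close>

lemma sorted_map_strict_mono:
  fixes t :: "nat \<Rightarrow> real"
  assumes "strict_mono_on {1..m} t"
  shows "sorted (map t [1..<Suc m])" "distinct (map t [1..<Suc m])"
proof -
  have set: "set [1..<Suc m] = {1..m}" by auto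
  show "sorted (map t [1..<Suc m])"
    unfolding sorted_map
    by (rule sorted_wrt_mono_rel[OF _ sorted_upt])
       (use assms in \<open>auto simp: set intro: mono_onD[OF strict_mono_on_imp_mono_on]\<close>)
  show "distinct (map t [1..<Suc m])"
    unfolding distinct_map set using strict_mono_on_imp_inj_on[OF assms] by simp
qed

lemma strict_mono_enumeration_unique:
  fixes t s :: "nat \<Rightarrow> real"
  assumes "t \<in> {1..m} \<rightarrow>\<^sub>E UNIV" "s \<in> {1..m} \<rightarrow>\<^sub>E UNIV"
    and "strict_mono_on {1..m} t" "strict_mono_on {1..m} s" "s ` {1..m} = t ` {1..m}"
  shows "s = t"
proof -
  have set: "set [1..<Suc m] = {1..m}" by auto
  have "map s [1..<Suc m] = map t [1..<Suc m]"
    by (rule sorted_distinct_set_unique)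
       (use assms sorted_map_strict_mono in \<open>simp_all only: set_map set\<close>)
  then have "\<forall>k\<in>{1..m}. s k = t k" by (simp only: map_eq_conv set)
  then show ?thesis using assms(1,2) by (intro PiE_ext) auto
qed

lemma strict_mono_enumeration_exists:
  fixes A :: "real set"
  assumes "finite A" "card A = m"
  shows "\<exists>t. t \<in> {1..m} \<rightarrow>\<^sub>E UNIV \<and> strict_mono_on {1..m} t \<and> t ` {1..m} = A"
proof -
  define xs where "xs = sorted_list_of_set A"
  have xs: "sorted xs" "distinct xs" "set xs = A" "length xs = m" using assms by (simp_all add: xs_def)
  define t where "t = (\<lambda>k\<in>{1..m}. xs ! (k - 1))"
  have "strict_mono_on {1..m} t"
  proof (rule strict_mono_onI)
    fix r s assume "r \<in> {1..m}" "s \<in> {1..m}" "r < s"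
    then show "t r < t s"
      using sorted_wrt_nth_less[of "(<)" xs "r - 1" "s - 1"] xs
      by (auto simp: t_def strict_sorted_iff)
  qed
  moreover have "t ` {1..m} = A"
  proof -
    have "t ` {1..m} = (\<lambda>k. xs ! (k - 1)) ` Suc ` {..<m}"
      unfolding t_def by (simp add: image_Suc_lessThan)
    also have "\<dots> = (!) xs ` {..<length xs}" by (simp add: image_image xs(4))
    also have "\<dots> = A" unfolding xs(3)[symmetric] by (auto simp: set_conv_nth)
    finally show ?thesis .
  qed
  moreover have "t \<in> {1..m} \<rightarrow>\<^sub>E UNIV" by (simp add: t_def)
  ultimately show ?thesis by blast
qed

section \<open>Monotonicity and range of the level function on a gap\<close>

lemma mem_gap_iff:
  assumes "k \<in> {1..Suc m}"
  shows "u \<in> gap (Suc m) t k \<longleftrightarrow> (k > 1 \<longrightarrow> t (k - 1) < u) \<and> (k \<le> m \<longrightarrow> u < t k)"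
  using assms by (auto simp: gap_def einterval_def ext_node_def)

lemma gap_less:
  assumes t: "strict_mono_on {1..m} t" and jk: "j \<in> {1..Suc m}" "k \<in> {1..Suc m}" "j < k"
    and u: "u \<in> gap (Suc m) t j" and v: "v \<in> gap (Suc m) t k"
  shows "u < v"
proof -
  have "u < t j" using u jk unfolding mem_gap_iff[OF jk(1)] by auto
  also have "t j \<le> t (k - 1)"
    using jk by (intro mono_onD[OF strict_mono_on_imp_mono_on[OF t]]) auto
  also have "\<dots> < v" using v jk unfolding mem_gap_iff[OF jk(2)] by auto
  finally show ?thesis .
qed

lemma gap_node_cases:
  assumes t: "strict_mono_on {1..m} t" and k: "k \<in> {1..Suc m}" and i: "i \<in> {1..m}"
  shows "(\<forall>u\<in>gap (Suc m) t k. t i < u) \<or> (\<forall>u\<in>gap (Suc m) t k. u < t i)"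
proof (cases "i < k")
  case True
  then have "t i \<le> t (k - 1)"
    using i k by (intro mono_onD[OF strict_mono_on_imp_mono_on[OF t]]) auto
  moreover have "t (k - 1) < u" if "u \<in> gap (Suc m) t k" for u
    using that True i unfolding mem_gap_iff[OF k] by simp
  ultimately show ?thesis by (blast intro: le_less_trans)
next
  case False
  then have "t k \<le> t i"
    using i k by (intro mono_onD[OF strict_mono_on_imp_mono_on[OF t]]) auto
  moreover have "u < t k" if "u \<in> gap (Suc m) t k" for u
    using that False i unfolding mem_gap_iff[OF k] by simp
  ultimately show ?thesis by (blast intro: less_le_trans)
qed

lemma ext_node_less:
  assumes "strict_mono_on {1..m} t" "k \<in> {1..Suc m}"
  shows "ext_node (Suc m) t (k - 1) < ext_node (Suc m) t k"
proof (cases "k = 1 \<or> k = Suc m")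
  case True
  then show ?thesis using assms(2) by (auto simp: ext_node_def)
next
  case False
  then have "t (k - 1) < t k" using assms(2) by (intro strict_mono_onD[OF assms(1)]) auto
  then show ?thesis using False assms(2) by (auto simp: ext_node_def)
qed

text \<open>Two points of one gap lie on the same side of every node, so all products
  \<open>(u - t i) * (v - t i)\<close> are positive. Hence the Bezoutian is positive, and with it
  the difference quotient of \<open>level\<close>.\<close>

lemma level_strict_mono:
  assumes \<zeta>: "\<forall>j\<in>{1..m}. Im (\<zeta> j) > 0" and m: "m > 0" and t: "strict_mono_on {1..m} t"
    and k: "k \<in> {1..Suc m}" and u: "u \<in> gap (Suc m) t k" and v: "v \<in> gap (Suc m) t k" and "u < v"
  shows "level m \<zeta> t u < level m \<zeta> t v"
proof -
  have inj: "inj_on t {1..m}" by (rule strict_mono_on_imp_inj_on[OF t])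
  have pos: "(u - t i) * (v - t i) > 0" if "i \<in> {1..m}" for i
    using gap_node_cases[OF t k that] u v by (auto intro: mult_pos_pos mult_neg_neg)
  have nt: "u \<notin> t ` {1..m}" "v \<notin> t ` {1..m}" using pos by force+
  have "pform {1..m} 1 (residue_weight m m \<zeta> t) (\<lambda>i. (u - t i) * (v - t i)) > 0"
  proof (rule pform_pos)
    show "residue_weight m m \<zeta> t i > 0" if "i \<in> {1..m}" for i
      by (rule residue_weight_pos[OF \<zeta> inj that])
    show "0 \<le> (u - t i) * (v - t i)" if "i \<in> {1..m}" for i using pos[OF that] by simp
  qed (use m pos in \<open>force+\<close>)
  with \<open>u < v\<close> have "(u - v) * pform {1..m} 1 (residue_weight m m \<zeta> t) (\<lambda>i. (u - t i) * (v - t i)) < 0"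
    by (simp add: mult_neg_pos)
  then have "(\<Prod>i=1..m. (u - t i) * (v - t i)) * (level m \<zeta> t u - level m \<zeta> t v) < 0"
    unfolding bezoutian_level[OF nt] .
  moreover have "(\<Prod>i=1..m. (u - t i) * (v - t i)) > 0" using pos by (rule prod_pos)
  ultimately show ?thesis by (simp add: mult_less_0_iff)
qed

lemma level_continuous:
  assumes "S \<inter> t ` {1..m} = {}"
  shows "continuous_on S (level m \<zeta> t)"
proof -
  have "u - t k \<noteq> 0" if "u \<in> S" "k \<in> {1..m}" for u k using assms that by auto
  then show ?thesis unfolding level_def by (intro continuous_intros) auto
qed

lemma level_near_node:
  assumes \<zeta>: "\<forall>j\<in>{1..m}. Im (\<zeta> j) > 0" and inj: "inj_on t {1..m}" and i: "i \<in> {1..m}"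
  shows "filterlim (level m \<zeta> t) at_top (at_left (t i))"
    and "filterlim (level m \<zeta> t) at_bot (at_right (t i))"
proof -
  let ?a = "residue_weight m m \<zeta> t"
  define r where "r u = u - (\<Sum>k\<in>{1..m} - {i}. ?a k / (u - t k))" for u
  have split: "level m \<zeta> t u = r u + ?a i * inverse (t i - u)" for u
  proof -
    have "(\<Sum>k=1..m. ?a k / (u - t k)) = ?a i / (u - t i) + (\<Sum>k\<in>{1..m} - {i}. ?a k / (u - t k))"
      using i by (intro sum.remove) auto
    moreover have "?a i / (u - t i) = - (?a i * inverse (t i - u))"
      by (metis divide_inverse inverse_minus_eq minus_diff_eq mult_minus_right)
    ultimately show ?thesis by (simp add: level_def r_def)
  qed
  have ne: "t i - t k \<noteq> 0" if "k \<in> {1..m} - {i}" for k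
    using inj_onD[OF inj, of i k] that i by auto
  have r: "(r \<longlongrightarrow> r (t i)) (at (t i) within S)" for S
    unfolding r_def by (intro tendsto_intros ne)
  have apos: "?a i > 0" by (rule residue_weight_pos[OF \<zeta> inj i])
  have lim0: "((\<lambda>u. t i - u) \<longlongrightarrow> 0) (at (t i) within S)" for S
  proof -
    have "((\<lambda>u. t i - u) \<longlongrightarrow> t i - t i) (at (t i) within S)" by (intro tendsto_intros)
    then show ?thesis by simp
  qed
  have "filterlim (\<lambda>u. inverse (t i - u)) at_top (at_left (t i))"
    by (rule filterlim_inverse_at_top[OF lim0]) (simp add: eventually_at_filter)
  then have "filterlim (\<lambda>u. ?a i * inverse (t i - u)) at_top (at_left (t i))"
    by (rule filterlim_tendsto_pos_mult_at_top[OF tendsto_const apos])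
  then show "filterlim (level m \<zeta> t) at_top (at_left (t i))"
    unfolding split[abs_def] by (rule filterlim_tendsto_add_at_top[OF r])
  have "filterlim (\<lambda>u. inverse (t i - u)) at_bot (at_right (t i))"
    by (rule filterlim_inverse_at_bot[OF lim0]) (simp add: eventually_at_filter)
  then have "filterlim (\<lambda>u. ?a i * inverse (t i - u)) at_bot (at_right (t i))"
    by (rule filterlim_tendsto_pos_mult_at_bot[OF tendsto_const apos])
  then show "filterlim (level m \<zeta> t) at_bot (at_right (t i))"
    unfolding split[abs_def] by (rule filterlim_tendsto_add_at_bot_iff[OF r, THEN iffD2])
qed

text \<open>Serves the two unbounded gaps: away from the nodes \<open>level\<close> differs from the
  identity by a bounded amount, so it is unbounded there.\<close>

lemma level_bound:
  assumes \<zeta>: "\<forall>j\<in>{1..m}. Im (\<zeta> j) > 0" and inj: "inj_on t {1..m}"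
    and u: "\<And>i. i \<in> {1..m} \<Longrightarrow> 1 \<le> \<bar>u - t i\<bar>"
  shows "\<bar>level m \<zeta> t u - u\<bar> \<le> (\<Sum>k=1..m. residue_weight m m \<zeta> t k)"
proof -
  have "\<bar>level m \<zeta> t u - u\<bar> = \<bar>\<Sum>k=1..m. residue_weight m m \<zeta> t k / (u - t k)\<bar>"
    by (simp add: level_def)
  also have "\<dots> \<le> (\<Sum>k=1..m. \<bar>residue_weight m m \<zeta> t k / (u - t k)\<bar>)" by (rule sum_abs)
  also have "\<dots> \<le> (\<Sum>k=1..m. residue_weight m m \<zeta> t k)"
  proof (rule sum_mono)
    fix k assume k: "k \<in> {1..m}"
    have a: "residue_weight m m \<zeta> t k > 0" by (rule residue_weight_pos[OF \<zeta> inj k])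
    have "residue_weight m m \<zeta> t k / \<bar>u - t k\<bar> \<le> residue_weight m m \<zeta> t k / 1"
      using u[OF k] a by (intro divide_left_mono) auto
    then show "\<bar>residue_weight m m \<zeta> t k / (u - t k)\<bar> \<le> residue_weight m m \<zeta> t k"
      using a by (simp add: abs_divide)
  qed
  finally show ?thesis .
qed

lemma level_unbounded_above:
  assumes \<zeta>: "\<forall>j\<in>{1..m}. Im (\<zeta> j) > 0" and m: "m > 0" and t: "strict_mono_on {1..m} t"
    and k: "k \<in> {1..Suc m}"
  shows "\<exists>u\<in>gap (Suc m) t k. l \<le> level m \<zeta> t u"
proof (cases "k = Suc m")
  case True
  have inj: "inj_on t {1..m}" by (rule strict_mono_on_imp_inj_on[OF t])
  \<comment> \<open>\<open>t m + 1\<close> keeps distance 1 from every node, so that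
    \<open>level_bound\<close> applies; the first entry compensates the error in that bound.\<close>
  define u where "u = max (l + (\<Sum>k=1..m. residue_weight m m \<zeta> t k)) (t m + 1)"
  have "1 \<le> \<bar>u - t i\<bar>" if "i \<in> {1..m}" for i
    using mono_onD[OF strict_mono_on_imp_mono_on[OF t], of i m] that by (auto simp: u_def)
  from level_bound[OF \<zeta> inj this] have "l \<le> level m \<zeta> t u" by (auto simp: u_def)
  moreover have "u \<in> gap (Suc m) t k"
    unfolding mem_gap_iff[OF k] using True
    by (simp add: u_def less_max_iff_disj min_less_iff_disj)
  ultimately show ?thesis by blast
next
  case False
  then have km: "k \<in> {1..m}" using k by auto
  have "\<forall>\<^sub>F u in at_left (t k). l \<le> level m \<zeta> t u"
    using level_near_node(1)[OF \<zeta> strict_mono_on_imp_inj_on[OF t] km] by (simp add: filterlim_at_top)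
  moreover have "\<forall>\<^sub>F u in at_left (t k). u \<in> gap (Suc m) t k"
  proof (cases "k > 1")
    case True
    have "t (k - 1) < t k" using True km by (intro strict_mono_onD[OF t]) auto
    then have "\<forall>\<^sub>F u in at_left (t k). u \<in> {t (k - 1)<..<t k}" by (rule eventually_at_left_real)
    then show ?thesis by eventually_elim (simp add: mem_gap_iff[OF k])
  next
    case False
    then show ?thesis unfolding mem_gap_iff[OF k] by (simp add: eventually_at_filter)
  qed
  ultimately have "\<forall>\<^sub>F u in at_left (t k). l \<le> level m \<zeta> t u \<and> u \<in> gap (Suc m) t k"
    by (rule eventually_conj)
  then show ?thesis using eventually_happens'[OF trivial_limit_at_left_real] by blast
qed

lemma level_unbounded_below:
  assumes \<zeta>: "\<forall>j\<in>{1..m}. Im (\<zeta> j) > 0" and m: "m > 0" and t: "strict_mono_on {1..m} t"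
    and k: "k \<in> {1..Suc m}"
  shows "\<exists>u\<in>gap (Suc m) t k. level m \<zeta> t u \<le> l"
proof (cases "k = 1")
  case True
  have inj: "inj_on t {1..m}" by (rule strict_mono_on_imp_inj_on[OF t])
  define u where "u = min (l - (\<Sum>k=1..m. residue_weight m m \<zeta> t k)) (t 1 - 1)"
  have "1 \<le> \<bar>u - t i\<bar>" if "i \<in> {1..m}" for i
    using mono_onD[OF strict_mono_on_imp_mono_on[OF t], of 1 i] that by (auto simp: u_def)
  from level_bound[OF \<zeta> inj this] have "level m \<zeta> t u \<le> l" by (auto simp: u_def)
  moreover have "u \<in> gap (Suc m) t k"
    unfolding mem_gap_iff[OF k] using True
    by (simp add: u_def less_max_iff_disj min_less_iff_disj)
  ultimately show ?thesis by blast
next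
  case False
  define i where "i = k - 1"
  have im: "i \<in> {1..m}" and ki: "k = Suc i" using False k by (auto simp: i_def)
  have "\<forall>\<^sub>F u in at_right (t i). level m \<zeta> t u \<le> l"
    using level_near_node(2)[OF \<zeta> strict_mono_on_imp_inj_on[OF t] im] by (simp add: filterlim_at_bot)
  moreover have "\<forall>\<^sub>F u in at_right (t i). u \<in> gap (Suc m) t k"
  proof (cases "k \<le> m")
    case True
    have "t i < t k" using True im ki by (intro strict_mono_onD[OF t]) auto
    then have "\<forall>\<^sub>F u in at_right (t i). u \<in> {t i<..<t k}" by (rule eventually_at_right_real)
    then show ?thesis unfolding mem_gap_iff[OF k] by eventually_elim (simp add: ki)
  next
    case False
    then show ?thesis unfolding mem_gap_iff[OF k] by (simp add: eventually_at_filter ki)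
  qed
  ultimately have "\<forall>\<^sub>F u in at_right (t i). level m \<zeta> t u \<le> l \<and> u \<in> gap (Suc m) t k"
    by (rule eventually_conj)
  then show ?thesis using eventually_happens'[OF trivial_limit_at_right_real] by blast
qed

lemma level_bij:
  assumes \<zeta>: "\<forall>j\<in>{1..m}. Im (\<zeta> j) > 0" and m: "m > 0" and t: "strict_mono_on {1..m} t"
    and k: "k \<in> {1..Suc m}"
  shows "\<exists>!u. u \<in> gap (Suc m) t k \<and> level m \<zeta> t u = l"
proof -
  obtain u v where u: "u \<in> gap (Suc m) t k" "level m \<zeta> t u \<le> l"
    and v: "v \<in> gap (Suc m) t k" "l \<le> level m \<zeta> t v"
    using level_unbounded_below[OF assms] level_unbounded_above[OF assms] by meson
  have "u \<le> v" using level_strict_mono[OF \<zeta> m t k v(1) u(1)] u v by force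
  have sub: "{u..v} \<subseteq> gap (Suc m) t k" using u(1) v(1) unfolding mem_gap_iff[OF k] by (auto simp: mem_gap_iff[OF k])
  have "gap (Suc m) t k \<inter> t ` {1..m} = {}" using gap_node_cases[OF t k] by fastforce
  then have "continuous_on {u..v} (level m \<zeta> t)" using sub by (intro level_continuous) auto
  then obtain w where "w \<in> {u..v}" "level m \<zeta> t w = l"
    using IVT'[of "level m \<zeta> t" u l v] u v \<open>u \<le> v\<close> by auto
  moreover have "x = y" if "x \<in> gap (Suc m) t k" "y \<in> gap (Suc m) t k" "level m \<zeta> t x = level m \<zeta> t y" for x y
    using level_strict_mono[OF \<zeta> m t k that(1,2)] level_strict_mono[OF \<zeta> m t k that(2,1)] that(3)
    by (cases x y rule: linorder_cases) auto
  ultimately show ?thesis using sub by (metis subsetD)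
qed

section \<open>Interlacing solutions and their dependence on one point\<close>

text \<open>Points in different gaps are distinct and avoid the nodes, so both directions of the
  level criterion apply. What is left of (ii) concerns only the inverses of \<open>level\<close> on
  the gaps.\<close>

lemma interlacing_solution_iff:
  assumes \<zeta>: "\<forall>j\<in>{1..m}. Im (\<zeta> j) > 0" and m: "m > 0" and t: "strict_mono_on {1..m} t"
    and sys: "stieltjes_system m m \<zeta> t" and k0: "k0 \<in> {1..Suc m}"
  shows "interlacing_solution (Suc m) \<zeta> t k0 u x \<longleftrightarrow>
    x \<in> (\<Pi>\<^sub>E k\<in>{1..Suc m}. gap (Suc m) t k) \<and> x k0 = u \<and>
    (\<forall>k\<in>{1..Suc m}. level m \<zeta> t (x k) = level m \<zeta> t u)"
proof (cases "x \<in> (\<Pi>\<^sub>E k\<in>{1..Suc m}. gap (Suc m) t k)")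
  case True
  then have x: "x k \<in> gap (Suc m) t k" if "k \<in> {1..Suc m}" for k using that by (rule PiE_mem)
  have nt: "x k \<notin> t ` {1..m}" if "k \<in> {1..Suc m}" for k
    using gap_node_cases[OF t that] x[OF that] by fastforce
  have inj: "inj_on x {1..Suc m}"
  proof (rule linorder_inj_onI')
    fix i j assume ij: "i \<in> {1..Suc m}" "j \<in> {1..Suc m}" "i < j"
    show "x i \<noteq> x j" using gap_less[OF t ij x[OF ij(1)] x[OF ij(2)]] by simp
  qed
  have "stieltjes_system (Suc m) m \<zeta> x \<longleftrightarrow> (\<forall>k\<in>{1..Suc m}. level m \<zeta> t (x k) = level m \<zeta> t (x k0))"
  proof
    assume "stieltjes_system (Suc m) m \<zeta> x"
    then show "\<forall>k\<in>{1..Suc m}. level m \<zeta> t (x k) = level m \<zeta> t (x k0)"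
      by (intro ballI stieltjes_system_level[OF \<zeta> m sys _ nt _ k0])
  next
    assume "\<forall>k\<in>{1..Suc m}. level m \<zeta> t (x k) = level m \<zeta> t (x k0)"
    then show "stieltjes_system (Suc m) m \<zeta> x"
      by (intro level_stieltjes_system[OF \<zeta> m sys inj nt]) blast+
  qed
  then show ?thesis using True by (auto simp: interlacing_solution_def)
qed (simp add: interlacing_solution_def)

text \<open>By surjectivity some value lies as close to an end of the target as desired, and
  monotonicity keeps all further values beyond it. The filters live on the extended reals in order
  to cover infinite ends, hence the composition with \<open>real_of_ereal\<close>.\<close>

lemma mono_onto_einterval_limits:
  assumes mono: "mono_on (einterval a b) f" and onto: "f ` einterval a b = einterval c d"
    and "a < b" "c < d"
  shows "((\<lambda>u. ereal (f (real_of_ereal u))) \<longlongrightarrow> c) (at_right a)"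
    and "((\<lambda>u. ereal (f (real_of_ereal u))) \<longlongrightarrow> d) (at_left b)"
proof -
  have cut: "\<exists>x\<in>einterval a b. e < ereal (f x) \<and> ereal (f x) < g"
    if "c \<le> e" "e < g" "g \<le> d" for e g
  proof -
    obtain y where y: "e < ereal y" "ereal y < g" using ereal_dense2[OF \<open>e < g\<close>] by blast
    then have "y \<in> einterval c d" using that by (auto simp: einterval_def)
    then show ?thesis using y onto by (metis imageE)
  qed
  have real: "real_of_ereal u \<in> einterval a b \<and> ereal (real_of_ereal u) = u" if "a < u" "u < b" for u
    using that by (cases u) (auto simp: einterval_def)
  have range: "c < ereal (f (real_of_ereal u))" "ereal (f (real_of_ereal u)) < d" if "a < u" "u < b" for u
    using real[OF that] onto by (auto simp: einterval_def set_eq_iff image_iff)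
  have inright: "\<forall>\<^sub>F u in at_right a. a < u \<and> u < x" if "a < x" for x
    using that by (auto simp: eventually_at_right[OF that])
  have inleft: "\<forall>\<^sub>F u in at_left b. x < u \<and> u < b" if "x < b" for x
    using that by (auto simp: eventually_at_left[OF that])
  show "((\<lambda>u. ereal (f (real_of_ereal u))) \<longlongrightarrow> c) (at_right a)"
  proof (rule order_tendstoI)
    fix e assume "e < c"
    show "\<forall>\<^sub>F u in at_right a. e < ereal (f (real_of_ereal u))"
      using inright[OF \<open>a < b\<close>] by eventually_elim (use range \<open>e < c\<close> in \<open>force intro: less_trans\<close>)
  next
    fix e assume "c < e"
    obtain x where x: "x \<in> einterval a b" "ereal (f x) < min e d"
      using cut[of c "min e d"] \<open>c < e\<close> \<open>c < d\<close> by auto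
    then have ax: "a < ereal x" "ereal x < b" by (auto simp: einterval_def)
    show "\<forall>\<^sub>F u in at_right a. ereal (f (real_of_ereal u)) < e"
      using inright[OF ax(1)]
    proof eventually_elim
      case (elim u)
      then have u: "a < u" "u < b" using ax by auto
      then have "f (real_of_ereal u) \<le> f x"
        using real[OF u] x(1) elim by (intro mono_onD[OF mono]) (auto simp flip: ereal_less_eq(3))
      then have "ereal (f (real_of_ereal u)) \<le> ereal (f x)" by simp
      also have "\<dots> < e" using x(2) by simp
      finally show ?case .
    qed
  qed
  show "((\<lambda>u. ereal (f (real_of_ereal u))) \<longlongrightarrow> d) (at_left b)"
  proof (rule order_tendstoI)
    fix e assume "d < e"
    show "\<forall>\<^sub>F u in at_left b. ereal (f (real_of_ereal u)) < e"
      using inleft[OF \<open>a < b\<close>] by eventually_elim (use range \<open>d < e\<close> in \<open>force intro: less_trans\<close>)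
  next
    fix e assume "e < d"
    obtain x where x: "x \<in> einterval a b" "max e c < ereal (f x)"
      using cut[of "max e c" d] \<open>e < d\<close> \<open>c < d\<close> by auto
    then have ax: "a < ereal x" "ereal x < b" by (auto simp: einterval_def)
    show "\<forall>\<^sub>F u in at_left b. e < ereal (f (real_of_ereal u))"
      using inleft[OF ax(2)]
    proof eventually_elim
      case (elim u)
      then have u: "a < u" "u < b" using ax by auto
      then have "f x \<le> f (real_of_ereal u)"
        using real[OF u] x(1) elim by (intro mono_onD[OF mono]) (auto simp flip: ereal_less_eq(3))
      have "e < ereal (f x)" using x(2) by simp
      also have "\<dots> \<le> ereal (f (real_of_ereal u))" using \<open>f x \<le> f (real_of_ereal u)\<close> by simp
      finally show ?case .
    qed
  qed
qed

lemma interlacing_solution_ex1: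
  assumes \<zeta>: "\<forall>j\<in>{1..m}. Im (\<zeta> j) > 0" and m: "m > 0" and t: "strict_mono_on {1..m} t"
    and sys: "stieltjes_system m m \<zeta> t" and k0: "k0 \<in> {1..Suc m}" and u: "u \<in> gap (Suc m) t k0"
  shows "\<exists>!x. interlacing_solution (Suc m) \<zeta> t k0 u x"
proof -
  let ?P = "\<lambda>k v. v \<in> gap (Suc m) t k \<and> level m \<zeta> t v = level m \<zeta> t u"
  have ex1: "\<exists>!v. ?P k v" if "k \<in> {1..Suc m}" for k by (rule level_bij[OF \<zeta> m t that])
  define x where "x = (\<lambda>k\<in>{1..Suc m}. THE v. ?P k v)"
  have x: "?P k (x k)" if "k \<in> {1..Suc m}" for k
    using theI'[OF ex1[OF that]] that by (simp add: x_def)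
  show ?thesis
    unfolding interlacing_solution_iff[OF \<zeta> m t sys k0]
  proof (intro ex1I[of _ x] conjI ballI)
    show "x \<in> (\<Pi>\<^sub>E k\<in>{1..Suc m}. gap (Suc m) t k)" using x by (auto simp: x_def)
    show "x k0 = u" using ex1[OF k0] x[OF k0] u by blast
    show "level m \<zeta> t (x k) = level m \<zeta> t u" if "k \<in> {1..Suc m}" for k using x[OF that] by blast
  next
    fix y assume y: "y \<in> (\<Pi>\<^sub>E k\<in>{1..Suc m}. gap (Suc m) t k) \<and> y k0 = u \<and>
      (\<forall>k\<in>{1..Suc m}. level m \<zeta> t (y k) = level m \<zeta> t u)"
    show "y = x"
    proof (rule PiE_ext)
      show "y \<in> (\<Pi>\<^sub>E k\<in>{1..Suc m}. gap (Suc m) t k)" using y by blast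
      show "x \<in> (\<Pi>\<^sub>E k\<in>{1..Suc m}. gap (Suc m) t k)" using x by (auto simp: x_def)
      fix k assume k: "k \<in> {1..Suc m}"
      have "?P k (y k)" using y k by (auto dest: PiE_mem)
      then show "y k = x k" using ex1[OF k] x[OF k] by blast
    qed
  qed
qed

text \<open>On the gap of \<open>k0\<close>, the map from u to \<open>X u k\<close> is
  \<open>level\<close> followed by the inverse of \<open>level\<close> on the gap of
  \<open>k\<close>, hence an increasing bijection between the two gaps.\<close>

lemma interlacing_solution_dependence:
  assumes \<zeta>: "\<forall>j\<in>{1..m}. Im (\<zeta> j) > 0" and m: "m > 0" and t: "strict_mono_on {1..m} t"
    and sys: "stieltjes_system m m \<zeta> t" and k0: "k0 \<in> {1..Suc m}" and k: "k \<in> {1..Suc m}"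
    and X: "\<forall>u\<in>gap (Suc m) t k0. interlacing_solution (Suc m) \<zeta> t k0 u (X u)"
  shows "continuous_on (gap (Suc m) t k0) (\<lambda>u. X u k)"
    and "mono_on (gap (Suc m) t k0) (\<lambda>u. X u k)"
    and "((\<lambda>u. ereal (X (real_of_ereal u) k)) \<longlongrightarrow> ext_node (Suc m) t (k - 1))
      (at_right (ext_node (Suc m) t (k0 - 1)))"
    and "((\<lambda>u. ereal (X (real_of_ereal u) k)) \<longlongrightarrow> ext_node (Suc m) t k)
      (at_left (ext_node (Suc m) t k0))"
proof -
  have X: "X u k \<in> gap (Suc m) t k" "level m \<zeta> t (X u k) = level m \<zeta> t u"
    if "u \<in> gap (Suc m) t k0" for u
    using X that k unfolding interlacing_solution_iff[OF \<zeta> m t sys k0] by (blast dest: PiE_mem)+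
  show mono: "mono_on (gap (Suc m) t k0) (\<lambda>u. X u k)"
  proof (rule mono_onI, rule ccontr)
    fix u v assume uv: "u \<in> gap (Suc m) t k0" "v \<in> gap (Suc m) t k0" "u \<le> v" "\<not> X u k \<le> X v k"
    have "level m \<zeta> t (X v k) < level m \<zeta> t (X u k)"
      using uv X by (intro level_strict_mono[OF \<zeta> m t k]) auto
    then have "level m \<zeta> t v < level m \<zeta> t u" using X(2)[OF uv(1)] X(2)[OF uv(2)] by simp
    then show False using level_strict_mono[OF \<zeta> m t k0 uv(1,2)] uv(3) by (cases "u = v") auto
  qed
  have onto: "(\<lambda>u. X u k) ` gap (Suc m) t k0 = gap (Suc m) t k"
  proof
    show "(\<lambda>u. X u k) ` gap (Suc m) t k0 \<subseteq> gap (Suc m) t k" using X(1) by blast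
    show "gap (Suc m) t k \<subseteq> (\<lambda>u. X u k) ` gap (Suc m) t k0"
    proof
      fix y assume y: "y \<in> gap (Suc m) t k"
      obtain u where u: "u \<in> gap (Suc m) t k0" "level m \<zeta> t u = level m \<zeta> t y"
        using level_bij[OF \<zeta> m t k0] by metis
      have "X u k = y" using level_bij[OF \<zeta> m t k, of "level m \<zeta> t y"] X[OF u(1)] u(2) y by metis
      then show "y \<in> (\<lambda>u. X u k) ` gap (Suc m) t k0" using u(1) by blast
    qed
  qed
  \<comment> \<open>A monotone function cannot jump if its image is open, here an open
    interval.\<close>
  show "continuous_on (gap (Suc m) t k0) (\<lambda>u. X u k)"
  proof (rule continuous_onI_mono)
    show "open ((\<lambda>u. X u k) ` gap (Suc m) t k0)" unfolding onto by (simp add: gap_def open_einterval)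
  qed (rule mono_onD[OF mono])
  note limits = mono_onto_einterval_limits[OF mono[unfolded gap_def] onto[unfolded gap_def]
      ext_node_less[OF t k0] ext_node_less[OF t k]]
  show "((\<lambda>u. ereal (X (real_of_ereal u) k)) \<longlongrightarrow> ext_node (Suc m) t (k - 1))
      (at_right (ext_node (Suc m) t (k0 - 1)))" by (rule limits(1))
  show "((\<lambda>u. ereal (X (real_of_ereal u) k)) \<longlongrightarrow> ext_node (Suc m) t k)
      (at_left (ext_node (Suc m) t k0))" by (rule limits(2))
qed

section \<open>Assembly of both parts\<close>

lemma ordered_solution_Suc:
  "ordered_solution (Suc m) \<zeta> t \<longleftrightarrow>
    t \<in> {1..m} \<rightarrow>\<^sub>E UNIV \<and> strict_mono_on {1..m} t \<and> stieltjes_system m m \<zeta> t"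
  by (simp add: ordered_solution_def)

lemma ordered_solution_ex1:
  assumes \<zeta>: "\<forall>j\<in>{1..m}. Im (\<zeta> j) > 0" and m: "m > 0"
  shows "\<exists>!t. ordered_solution (Suc m) \<zeta> t"
proof -
  obtain r where r: "stieltjes_system m m \<zeta> r" using energy_minimum[OF \<zeta>] by blast
  then have "inj_on r {1..m}" by (simp add: stieltjes_system_def)
  then have "card (r ` {1..m}) = m" by (simp add: card_image)
  then obtain t where t: "t \<in> {1..m} \<rightarrow>\<^sub>E UNIV" "strict_mono_on {1..m} t" "t ` {1..m} = r ` {1..m}"
    using strict_mono_enumeration_exists[of "r ` {1..m}" m] by blast
  have "stieltjes_system m m \<zeta> t"
    by (rule stieltjes_system_image_eq[OF strict_mono_on_imp_inj_on[OF t(2)] t(3) r])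
  with t(1,2) show ?thesis
    unfolding ordered_solution_Suc
  proof (intro ex1I[of _ t] conjI)
    fix s assume "s \<in> {1..m} \<rightarrow>\<^sub>E UNIV \<and> strict_mono_on {1..m} s \<and> stieltjes_system m m \<zeta> s"
    then show "s = t"
      using t(1,2) stieltjes_system_unique[OF \<zeta> m \<open>stieltjes_system m m \<zeta> t\<close>]
      by (intro strict_mono_enumeration_unique) blast+
  qed
qed

lemma stieltjes_system_permutation:
  assumes \<zeta>: "\<forall>j\<in>{1..m}. Im (\<zeta> j) > 0" and m: "m > 0"
    and t: "stieltjes_system m m \<zeta> t" and s: "stieltjes_system m m \<zeta> s"
  shows "\<exists>\<pi>. \<pi> permutes {1..m} \<and> (\<forall>k\<in>{1..m}. s k = t (\<pi> k))"
proof -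
  have inj: "inj_on t {1..m}" "inj_on s {1..m}" using s t by (auto simp: stieltjes_system_def)
  have img: "s ` {1..m} = t ` {1..m}" by (rule stieltjes_system_unique[OF \<zeta> m t s])
  define \<pi> where "\<pi> k = (if k \<in> {1..m} then inv_into {1..m} t (s k) else k)" for k
  have "bij_betw s {1..m} (t ` {1..m})" using inj img by (simp add: bij_betw_def)
  moreover have "bij_betw (inv_into {1..m} t) (t ` {1..m}) {1..m}"
    using inj by (intro bij_betw_inv_into) (simp add: bij_betw_def)
  ultimately have "bij_betw (inv_into {1..m} t \<circ> s) {1..m} {1..m}" by (rule bij_betw_trans)
  then have "bij_betw \<pi> {1..m} {1..m}" by (rule bij_betw_cong[THEN iffD1, rotated]) (simp add: \<pi>_def)
  then have "\<pi> permutes {1..m}" by (rule bij_imp_permutes) (simp only: \<pi>_def if_False)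
  moreover have "s k = t (\<pi> k)" if k: "k \<in> {1..m}" for k
  proof -
    have "s k \<in> t ` {1..m}" using img k by blast
    then show ?thesis using k by (simp add: \<pi>_def f_inv_into_f)
  qed
  ultimately show ?thesis by blast
qed

theorem theorem2:
  fixes n :: nat and \<zeta> :: "nat \<Rightarrow> complex"
  assumes "n \<ge> 2"
    and "\<forall>j\<in>{1..n-1}. Im (\<zeta> j) > 0"
  shows "(\<exists>!t. ordered_solution n \<zeta> t) \<and>
    (\<forall>t. ordered_solution n \<zeta> t \<longrightarrow>
       (\<forall>s. inj_on s {1..n-1} \<longrightarrow> energy (n - 1) \<zeta> t \<le> energy (n - 1) \<zeta> s) \<and>
       energy_critical_point (n - 1) \<zeta> t \<and>
       (\<forall>s. energy_critical_point (n - 1) \<zeta> s \<longrightarrow>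
          (\<exists>\<pi>. \<pi> permutes {1..n-1} \<and> (\<forall>k\<in>{1..n-1}. s k = t (\<pi> k)))) \<and>
       (\<forall>k0\<in>{1..n}.
          (\<forall>u\<in>gap n t k0. \<exists>!x. interlacing_solution n \<zeta> t k0 u x) \<and>
          (\<forall>X. (\<forall>u\<in>gap n t k0. interlacing_solution n \<zeta> t k0 u (X u)) \<longrightarrow>
             (\<forall>k\<in>{1..n}.
                continuous_on (gap n t k0) (\<lambda>u. X u k) \<and>
                mono_on (gap n t k0) (\<lambda>u. X u k) \<and>
                ((\<lambda>u. ereal (X (real_of_ereal u) k)) \<longlongrightarrow> ext_node n t (k - 1))
                  (at_right (ext_node n t (k0 - 1))) \<and>
                ((\<lambda>u. ereal (X (real_of_ereal u) k)) \<longlongrightarrow> ext_node n t k)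
                  (at_left (ext_node n t k0))))))"
proof -
  define m where "m = n - 1"
  have n: "n = Suc m" and m: "m > 0" using assms(1) by (auto simp: m_def)
  have \<zeta>: "\<forall>j\<in>{1..m}. Im (\<zeta> j) > 0" using assms(2) by (simp add: m_def)
  show ?thesis
    unfolding n diff_Suc_1
  proof (intro conjI allI impI ballI)
    show "\<exists>!t. ordered_solution (Suc m) \<zeta> t" by (rule ordered_solution_ex1[OF \<zeta> m])
  next
    fix t assume "ordered_solution (Suc m) \<zeta> t"
    then have t: "strict_mono_on {1..m} t" and sys: "stieltjes_system m m \<zeta> t"
      unfolding ordered_solution_Suc by blast+
    obtain r where r: "stieltjes_system m m \<zeta> r"
      "\<And>s. inj_on s {1..m} \<Longrightarrow> energy m \<zeta> r \<le> energy m \<zeta> s"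
      using energy_minimum[OF \<zeta>] by blast
    \<comment> \<open>The minimizer \<open>r\<close> need not be increasing, but it has the same set
      of points as \<open>t\<close>.\<close>
    have "energy m \<zeta> t = energy m \<zeta> r"
      using sys r(1) stieltjes_system_unique[OF \<zeta> m r(1) sys]
      by (intro energy_image_eq) (auto simp: stieltjes_system_def)
    then show "energy m \<zeta> t \<le> energy m \<zeta> s" if "inj_on s {1..m}" for s using r(2)[OF that] by simp
    show "energy_critical_point m \<zeta> t" unfolding energy_critical_point_iff[OF \<zeta>] by (rule sys)
    show "\<exists>\<pi>. \<pi> permutes {1..m} \<and> (\<forall>k\<in>{1..m}. s k = t (\<pi> k))"
      if "energy_critical_point m \<zeta> s" for s
      using that unfolding energy_critical_point_iff[OF \<zeta>]
      by (rule stieltjes_system_permutation[OF \<zeta> m sys])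
    fix k0 assume k0: "k0 \<in> {1..Suc m}"
    show "\<exists>!x. interlacing_solution (Suc m) \<zeta> t k0 u x" if "u \<in> gap (Suc m) t k0" for u
      by (rule interlacing_solution_ex1[OF \<zeta> m t sys k0 that])
    fix X k assume "\<forall>u\<in>gap (Suc m) t k0. interlacing_solution (Suc m) \<zeta> t k0 u (X u)" "k \<in> {1..Suc m}"
    note dep = interlacing_solution_dependence[OF \<zeta> m t sys k0 this(2,1)]
    show "continuous_on (gap (Suc m) t k0) (\<lambda>u. X u k)" by (rule dep)
    show "mono_on (gap (Suc m) t k0) (\<lambda>u. X u k)" by (rule dep)
    show "((\<lambda>u. ereal (X (real_of_ereal u) k)) \<longlongrightarrow> ext_node (Suc m) t (k - 1))
        (at_right (ext_node (Suc m) t (k0 - 1)))" by (rule dep)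
    show "((\<lambda>u. ereal (X (real_of_ereal u) k)) \<longlongrightarrow> ext_node (Suc m) t k)
        (at_left (ext_node (Suc m) t k0))" by (rule dep)
  qed
qed

end
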